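(* Let $p\geq 2$ be an integer, let $G$ be a graph with $n$ vertices whose bipartite pathwidth is at most $p$, and let $\lambda\geq e^9/n$ be real. Then the Glauber dynamics with fugacity $\lambda$ on $\mathcal{I}(G)$, started from the initial state $\emptyset$, has mixing time \[ \tau_\emptyset(\varepsilon) \leq 2e\,\alpha(G)\, n^{p+1}\, \lambda^p\Big(1+\max(\lambda,1/\lambda)\Big)\Big(\alpha(G)\ln(n\lambda)+1+\ln(1/\varepsilon)\Big)\] for every $\varepsilon>0$. In particular, when $p$ is constant this upper bound is polynomial in $n$ and $\max(\lambda,1/\lambda)$ (for fixed $\varepsilon$, and logarithmic in $1/\varepsilon$).
   Context: All graphs are finite, simple and undirected. $\mathcal{I}(G)$ is the set of independent sets of $G$ (including $\emptyset$), and $\alpha(G)$ is the maximum size of an independent set. A path decomposition of $G=(V,E)$ is a sequence $(B_1,\dots,B_r)$ of subsets of $V$ such that every vertex lies in some $B_i$, every edge is contained in some $B_i$, and for each vertex $v$ the set $\{i: v\in B_i\}$ is an interval; its width is $\max_i|B_i|-1$, and the pathwidth $\mathrm{pw}(G)$ is the minimum width of a path decomposition. The bipartite pathwidth of $G$ is the maximum of $\mathrm{pw}(H)$ over all induced subgraphs $H$ of $G$ that are bipartite. The Glauber dynamics with fugacity $\lambda>0$ is the Markov chain on $\mathcal{I}(G)$ which, from state $Z$, chooses a vertex $v$ uniformly at random and: if $v\in Z$, moves to $Z\setminus\{v\}$ with probability $1/(1+\lambda)$; if $v\notin Z$ and $Z\cup\{v\}$ is independent, moves to $Z\cup\{v\}$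 with probability $\lambda/(1+\lambda)$; otherwise stays at $Z$. Its stationary distribution is $\pi(Z)=\lambda^{|Z|}/P_G(\lambda)$ with $P_G(\lambda)=\sum_{I\in\mathcal{I}(G)}\lambda^{|I|}$. If $p_t$ denotes the distribution after $t$ steps started from state $x$, the mixing time is $\tau_x(\varepsilon)=\min\{t: \frac12\sum_{Z}|p_t(Z)-\pi(Z)|\leq\varepsilon\}$.
   Formalization: The right-hand side is replaced by its maximum with 0, because for very large ε (ln ε > α(G) ln(nλ)+1) the displayed bound is negative while the mixing time is 0; whenever the bound is nonnegative, in particular for ε ≤ 1, it is unchanged. *)

theory Defs
  imports "HOL-Probability.Probability" "Graph_Theory.Digraph_Component"
begin

text \<open>
  Finite simple undirected graphs are modelled by the locale predicate \<^const>\<open>graph\<close>: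
  finite, loop-free, symmetric digraphs without parallel arcs. An undirected edge is
  a pair of opposite arcs.
\<close>

definition independent_in :: "('a, 'b) pre_digraph \<Rightarrow> 'a set \<Rightarrow> bool" where
  "independent_in G I \<longleftrightarrow>
     I \<subseteq> verts G \<and> (\<forall>u\<in>I. \<forall>v\<in>I. (u, v) \<notin> arcs_ends G)"

definition indep_sets_of :: "('a, 'b) pre_digraph \<Rightarrow> 'a set set" where
  "indep_sets_of G = {I. independent_in G I}"

definition independence_number :: "('a, 'b) pre_digraph \<Rightarrow> nat" where
  "independence_number G = Max (card ` indep_sets_of G)"

definition bipartite :: "('a, 'b) pre_digraph \<Rightarrow> bool" where
  "bipartite G \<longleftrightarrow>
     (\<exists>A B. A \<union> B = verts G \<and> A \<inter> B = {} \<and>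
            independent_in G A \<and> independent_in G B)"

definition path_decomposition :: "('a, 'b) pre_digraph \<Rightarrow> 'a set list \<Rightarrow> bool" where
  "path_decomposition G Bs \<longleftrightarrow>
     Bs \<noteq> [] \<and>
     (\<forall>B\<in>set Bs. B \<subseteq> verts G) \<and>
     (\<forall>v\<in>verts G. \<exists>B\<in>set Bs. v \<in> B) \<and>
     (\<forall>(u, v)\<in>arcs_ends G. \<exists>B\<in>set Bs. u \<in> B \<and> v \<in> B) \<and>
     (\<forall>v\<in>verts G. \<forall>i j k. i \<le> j \<longrightarrow> j \<le> k \<longrightarrow> k < length Bs \<longrightarrow>
        v \<in> Bs ! i \<longrightarrow> v \<in> Bs ! k \<longrightarrow> v \<in> Bs ! j)"

text \<open>Integer-valued, because the null graph has pathwidth \<open>-1\<close>.\<close>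

definition pd_width :: "'a set list \<Rightarrow> int" where
  "pd_width Bs = int (Max (card ` set Bs)) - 1"

definition pathwidth :: "('a, 'b) pre_digraph \<Rightarrow> int" where
  "pathwidth G = Inf (pd_width ` {Bs. path_decomposition G Bs})"

definition bipartite_pathwidth :: "('a, 'b) pre_digraph \<Rightarrow> int" where
  "bipartite_pathwidth G = Max (pathwidth ` {H. induced_subgraph H G \<and> bipartite H})"

definition glauber_step :: "('a, 'b) pre_digraph \<Rightarrow> real \<Rightarrow> 'a set \<Rightarrow> 'a set pmf" where
  "glauber_step G lam Z =
     bind_pmf (pmf_of_set (verts G)) (\<lambda>v.
       if v \<in> Z then
         map_pmf (\<lambda>b. if b then Z - {v} else Z) (bernoulli_pmf (1 / (1 + lam)))
       else if independent_in G (insert v Z) then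
         map_pmf (\<lambda>b. if b then insert v Z else Z) (bernoulli_pmf (lam / (1 + lam)))
       else return_pmf Z)"

definition hardcore_partition :: "('a, 'b) pre_digraph \<Rightarrow> real \<Rightarrow> real" where
  "hardcore_partition G lam = (\<Sum>I\<in>indep_sets_of G. lam ^ card I)"

definition hardcore :: "('a, 'b) pre_digraph \<Rightarrow> real \<Rightarrow> 'a set \<Rightarrow> real" where
  "hardcore G lam Z = lam ^ card Z / hardcore_partition G lam"

primrec chain_dist :: "('s \<Rightarrow> 's pmf) \<Rightarrow> 's \<Rightarrow> nat \<Rightarrow> 's pmf" where
  "chain_dist K x 0 = return_pmf x"
| "chain_dist K x (Suc t) = bind_pmf (chain_dist K x t) K"

text \<open>The mixing time is \<open>\<infinity>\<close> if no number of steps brings the chain within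
  distance \<open>\<epsilon>\<close>; the infimum of a nonempty set of \<^typ>\<open>enat\<close> is attained.\<close>

definition mixing_time ::
    "('s \<Rightarrow> 's pmf) \<Rightarrow> 's set \<Rightarrow> ('s \<Rightarrow> real) \<Rightarrow> 's \<Rightarrow> real \<Rightarrow> enat" where
  "mixing_time K S \<pi> x \<epsilon> =
     Inf {enat t | t. 1 / 2 * (\<Sum>Z\<in>S. \<bar>pmf (chain_dist K x t) Z - \<pi> Z\<bar>) \<le> \<epsilon>}"

definition glauber_mixing_time :: "('a, 'b) pre_digraph \<Rightarrow> real \<Rightarrow> 'a set \<Rightarrow> real \<Rightarrow> enat" where
  "glauber_mixing_time G lam x \<epsilon> =
     mixing_time (glauber_step G lam) (indep_sets_of G) (hardcore G lam) x \<epsilon>"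

text \<open>\<open>a\<close> stands for the independence number and \<open>n\<close> for the number of vertices.
  Pitfall: the last factor is negative once \<open>\<epsilon> > exp 1 * (n * lam) ^ a\<close>, where the mixing
  time is \<open>0\<close>; an upper bound valid for all \<open>\<epsilon>\<close> is therefore \<open>max 0\<close> of this expression.\<close>

definition mixing_bound :: "nat \<Rightarrow> nat \<Rightarrow> nat \<Rightarrow> real \<Rightarrow> real \<Rightarrow> real" where
  "mixing_bound p n a lam \<epsilon> =
     2 * exp 1 * real a * real n ^ (p + 1) * lam ^ p * (1 + max lam (1 / lam)) *
     (real a * ln (real n * lam) + 1 + ln (1 / \<epsilon>))"

end

theory Submission
  imports Defs
begin

text \<open>
  The relaxation time is bounded with canonical paths. For independent sets \<open>X\<close>, \<open>Y\<close> the
  symmetric difference induces a bipartite graph and hence has a path decomposition into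
  bags of size at most \<open>p + 1\<close>. Sweeping through the bags, the path from \<open>X\<close> to \<open>Y\<close> removes
  the vertices of \<open>X\<close> when they first occur in a bag and inserts those of \<open>Y\<close> at their last
  occurrence. The complement of the current state in the symmetric difference, with the
  at most \<open>p\<close> missing vertices of the current bag deleted, is again independent, and
  together with these vertices it determines \<open>X\<close> and \<open>Y\<close>. This bounds the congestion and gives
  a Poincare inequality. Each heat bath update of a single vertex is an orthogonal
  projection, so the transition operator is positive semidefinite and the Poincare
  inequality alone controls its norm on functions of mean zero.
\<close>

section \<open>Path decompositions as interval schedules\<close>

text \<open>A path decomposition laid out in linear time: \<open>u\<close> is alive on
  [\<open>A u\<close>, \<open>B u\<close>], and distinct endpoints allow only one event at a time.
  For symmetric \<open>E\<close> the adjacency clause makes the intervals of adjacent vertices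
  overlap.\<close>

definition interval_schedule :: "('a \<times> 'a) set \<Rightarrow> nat \<Rightarrow> 'a set \<Rightarrow> ('a \<Rightarrow> nat) \<Rightarrow> ('a \<Rightarrow> nat) \<Rightarrow> bool" where
  "interval_schedule E k U A B \<longleftrightarrow>
     inj_on A U \<and> inj_on B U \<and> A ` U \<inter> B ` U = {} \<and> (\<forall>u\<in>U. A u < B u) \<and>
     (\<forall>u\<in>U. \<forall>v\<in>U. (u, v) \<in> E \<longrightarrow> A u < B v) \<and>
     (\<forall>t. card {u\<in>U. A u \<le> t \<and> t \<le> B u} \<le> k)"

text \<open>Bag \<open>i\<close> is stretched over two blocks of \<open>n\<close> time slots, one
  for the vertices that enter with it and one for those that leave. A vertex alive in either block
  lies in bag \<open>i\<close>, so bag sizes bound the number of live vertices.\<close>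

lemma path_decomposition_imp_interval_schedule:
  assumes pd: "path_decomposition H Bs" and k: "\<And>B. B \<in> set Bs \<Longrightarrow> card B \<le> k"
    and fin: "finite (verts H)"
  shows "\<exists>A B. interval_schedule (arcs_ends H) k (verts H) A B"
proof -
  have sub: "\<forall>B\<in>set Bs. B \<subseteq> verts H"
    and cover: "\<forall>v\<in>verts H. \<exists>B\<in>set Bs. v \<in> B"
    and edge: "\<forall>(u, v)\<in>arcs_ends H. \<exists>B\<in>set Bs. u \<in> B \<and> v \<in> B"
    and conv: "\<forall>v\<in>verts H. \<forall>i j k. i \<le> j \<longrightarrow> j \<le> k \<longrightarrow> k < length Bs \<longrightarrow>
        v \<in> Bs ! i \<longrightarrow> v \<in> Bs ! k \<longrightarrow> v \<in> Bs ! j"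
    using pd unfolding path_decomposition_def by simp_all
  define n where "n = card (verts H)"
  obtain idx where idx: "bij_betw idx (verts H) {0..<n}"
    using ex_bij_betw_finite_nat[OF fin] unfolding n_def by blast
  have idx_lt: "idx u < n" if "u \<in> verts H" for u
    using idx that by (auto simp: bij_betw_def)
  define bag where "bag u = {i. i < length Bs \<and> u \<in> Bs ! i}" for u
  have fin_bag: "finite (bag u)" for u by (simp add: bag_def)
  have bag_ne: "bag u \<noteq> {}" if u: "u \<in> verts H" for u
  proof -
    obtain C where "C \<in> set Bs" "u \<in> C" using cover u by blast
    then show ?thesis unfolding bag_def by (auto simp: in_set_conv_nth)
  qed
  define a where "a u = Min (bag u)" for u
  define b where "b u = Max (bag u)" for u
  have a_in: "a u \<in> bag u" and b_in: "b u \<in> bag u" if "u \<in> verts H" for u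
    using fin_bag bag_ne[OF that] unfolding a_def b_def by auto
  have a_le: "a u \<le> i" and b_ge: "i \<le> b u" if "i \<in> bag u" for i u
    using fin_bag that unfolding a_def b_def by auto
  have between: "i \<in> bag u" if "u \<in> verts H" "a u \<le> i" "i \<le> b u" for i u
  proof -
    have "a u < length Bs" "u \<in> Bs ! a u" "b u < length Bs" "u \<in> Bs ! b u"
      using a_in[OF that(1)] b_in[OF that(1)] by (auto simp: bag_def)
    moreover have "\<And>i j k. i \<le> j \<Longrightarrow> j \<le> k \<Longrightarrow> k < length Bs \<Longrightarrow> u \<in> Bs ! i \<Longrightarrow> u \<in> Bs ! k \<Longrightarrow> u \<in> Bs ! j"
      using bspec[OF conv that(1)] by blast
    ultimately show ?thesis using that by (auto simp: bag_def)
  qed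
  text \<open>The parity separates first from last occurrences, and \<open>idx\<close> breaks ties between vertices.\<close>
  define A where "A u = 2 * a u * n + idx u" for u
  define B where "B u = (2 * b u + 1) * n + idx u" for u
  have div_mod: "A u div n = 2 * a u" "A u mod n = idx u" "B u div n = 2 * b u + 1" "B u mod n = idx u"
    if "u \<in> verts H" for u
    using idx_lt[OF that] unfolding A_def B_def by (simp_all del: mult_Suc mult_Suc_right add: div_mult_self3 mod_mult_self3)
  have idx_inj: "u = v" if "u \<in> verts H" "v \<in> verts H" "idx u = idx v" for u v
    using idx that unfolding bij_betw_def inj_on_def by blast
  have inj_A: "inj_on A (verts H)"
    by (rule inj_onI, rule idx_inj) (simp_all flip: div_mod(2))
  have inj_B: "inj_on B (verts H)"
    by (rule inj_onI, rule idx_inj) (simp_all flip: div_mod(4))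
  have disj: "A ` verts H \<inter> B ` verts H = {}"
  proof -
    have "A u \<noteq> B v" if "u \<in> verts H" "v \<in> verts H" for u v
    proof
      assume "A u = B v"
      then have "2 * a u = 2 * b v + 1" using div_mod(1)[OF that(1)] div_mod(3)[OF that(2)] by simp
      then show False by presburger
    qed
    then show ?thesis by blast
  qed
  have less: "A u < B v" if "u \<in> verts H" "v \<in> verts H" "i \<in> bag u" "i \<in> bag v" for u v i
  proof -
    have "a u \<le> b v" using a_le[OF that(3)] b_ge[OF that(4)] by simp
    then have "A u div n < B v div n" using div_mod that by simp
    then show ?thesis using div_le_mono[of "B v" "A u" n] by linarith
  qed
  have adj: "A u < B v" if uv: "u \<in> verts H" "v \<in> verts H" "(u, v) \<in> arcs_ends H" for u v
  proof -
    obtain C where "C \<in> set Bs" "u \<in> C" "v \<in> C"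
      using bspec[OF edge uv(3)] by auto
    then obtain i where "i \<in> bag u" "i \<in> bag v" unfolding bag_def by (auto simp: in_set_conv_nth)
    with uv less show ?thesis by blast
  qed
  have width: "card {u \<in> verts H. A u \<le> t \<and> t \<le> B u} \<le> k" for t
  proof -
    \<comment> \<open>The bag whose two blocks contain \<open>t\<close>. Without vertices
      \<open>n = 0\<close> and the division gives 0; \<open>in_bag\<close> is then vacuous.\<close>
    define i where "i = t div n div 2"
    have in_bag: "i \<in> bag u" if "u \<in> verts H" "A u \<le> t" "t \<le> B u" for u
    proof -
      have "2 * a u \<le> t div n" "t div n \<le> 2 * b u + 1"
        using div_le_mono[OF that(2), of n] div_le_mono[OF that(3), of n] div_mod[OF that(1)] by auto
      then have "a u \<le> i" "i \<le> b u" unfolding i_def by auto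
      then show ?thesis using between that by blast
    qed
    show ?thesis
    proof (cases "i < length Bs")
      case True
      then have B: "Bs ! i \<in> set Bs" by simp
      have "{u \<in> verts H. A u \<le> t \<and> t \<le> B u} \<subseteq> Bs ! i" using in_bag bag_def by auto
      moreover have "finite (Bs ! i)"
        using sub B fin finite_subset by blast
      ultimately show ?thesis using k[OF B] card_mono le_trans by blast
    next
      case False
      then have "{u \<in> verts H. A u \<le> t \<and> t \<le> B u} = {}" using in_bag bag_def by auto
      then show ?thesis by (metis card.empty le0)
    qed
  qed
  have "A u < B u" if "u \<in> verts H" for u using less[OF that that] a_in that by blast
  then have "interval_schedule (arcs_ends H) k (verts H) A B"
    unfolding interval_schedule_def using inj_A inj_B disj adj width by simp
  then show ?thesis by blast
qed

section \<open>From bipartite pathwidth to path decompositions of small width\<close>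

lemma finite_induced_subgraphs:
  assumes "fin_digraph G"
  shows "finite {H. induced_subgraph H G}"
proof -
  interpret fin_digraph G by fact
  have "{H. induced_subgraph H G} \<subseteq> (\<lambda>U. G \<restriction> U) ` Pow (verts G)"
  proof
    fix H assume "H \<in> {H. induced_subgraph H G}"
    then have "verts H \<subseteq> verts G" "H = G \<restriction> verts H"
      by (auto simp: induced_subgraph_def subgraph_def compatible_def induce_subgraph_def)
    then show "H \<in> (\<lambda>U. G \<restriction> U) ` Pow (verts G)" by blast
  qed
  then show ?thesis by (rule finite_subset) simp
qed

text \<open>The single bag \<open>verts H\<close> shows that decompositions exist, so some width
  lies below \<open>k + 1\<close>, hence is at most \<open>k\<close> because widths are
  integers.\<close>

lemma pathwidth_le_obtains:
  assumes "wf_digraph H" "pathwidth H \<le> k"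
  obtains Bs where "path_decomposition H Bs" "pd_width Bs \<le> k"
proof -
  interpret wf_digraph H by fact
  let ?W = "pd_width ` {Bs. path_decomposition H Bs}"
  have "path_decomposition H [verts H]"
    by (auto simp: path_decomposition_def adj_in_verts)
  then have "?W \<noteq> {}" by blast
  moreover have "Inf ?W < k + 1" using assms(2) unfolding pathwidth_def by simp
  ultimately have "\<exists>x\<in>?W. x < k + 1" by (rule cInf_lessD)
  then show thesis using that by auto
qed

section \<open>Canonical paths\<close>

lemma arcs_ends_induce_subgraph:
  "arcs_ends (G \<restriction> U) = arcs_ends G \<inter> U \<times> U"
  by (auto simp: arcs_ends_def arc_to_ends_def induce_subgraph_def)

lemma bipartite_sym_diff:
  assumes "independent_in G X" "independent_in G Y"
  shows "bipartite (G \<restriction> (sym_diff X Y))"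
  unfolding bipartite_def
  by (rule exI[of _ "X - Y"], rule exI[of _ "Y - X"])
     (use assms in \<open>auto simp: independent_in_def arcs_ends_induce_subgraph\<close>)

lemma bipartite_pathwidth_imp_schedule:
  assumes G: "graph G" and pw: "bipartite_pathwidth G \<le> int p"
    and ind: "independent_in G X" "independent_in G Y"
  shows "\<exists>A B. interval_schedule (arcs_ends G) (p + 1) (sym_diff X Y) A B"
proof -
  interpret graph G by fact
  define U where "U = sym_diff X Y"
  have U: "U \<subseteq> verts G" using ind by (auto simp: U_def independent_in_def)
  let ?H = "G \<restriction> U"
  have "finite (pathwidth ` {H. induced_subgraph H G \<and> bipartite H})"
    using finite_induced_subgraphs[OF fin_digraph_axioms] by (intro finite_imageI) simp
  moreover have "induced_subgraph ?H G \<and> bipartite ?H"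
    using induced_induce[OF U] bipartite_sym_diff[OF ind] by (simp add: U_def)
  ultimately have "pathwidth ?H \<le> bipartite_pathwidth G"
    unfolding bipartite_pathwidth_def by (intro Max_ge) auto
  with pw have "pathwidth ?H \<le> int p" by simp
  moreover have "wf_digraph ?H"
    using induced_induce[OF U] by (simp add: induced_subgraph_def subgraph_def)
  ultimately obtain Bs where Bs: "path_decomposition ?H Bs" "pd_width Bs \<le> int p"
    using pathwidth_le_obtains by blast
  have "card C \<le> p + 1" if "C \<in> set Bs" for C
  proof -
    have "card C \<le> Max (card ` set Bs)" using that by (intro Max_ge) auto
    then show ?thesis using Bs(2) by (simp add: pd_width_def)
  qed
  moreover have "finite (verts ?H)" using finite_subset[OF U finite_verts] by simp
  ultimately obtain A B where "interval_schedule (arcs_ends ?H) (p + 1) (verts ?H) A B"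
    using path_decomposition_imp_interval_schedule[OF Bs(1)] by blast
  then have "interval_schedule (arcs_ends G) (p + 1) U A B"
    unfolding interval_schedule_def by (simp add: arcs_ends_induce_subgraph)
  then show ?thesis unfolding U_def by blast
qed

text \<open>
  On the canonical path from \<open>X\<close> to \<open>Y\<close>, a vertex \<open>u\<close> of \<open>X - Y\<close> is removed at time \<open>A u\<close>,
  and a vertex \<open>u\<close> of \<open>Y - X\<close> is inserted at time \<open>B u\<close>. The transition that flips \<open>u\<close>
  joins \<open>flip_set u\<close> and \<open>flip_set u - {u}\<close>.
\<close>

definition path_state where
  "path_state A B X Y (t :: nat) = (X \<inter> Y) \<union> {w\<in>X - Y. t \<le> A w} \<union> {w\<in>Y - X. B w < t}"

definition flip_time where
  "flip_time A B X u = (if u \<in> X then A u else B u :: nat)"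

definition flip_set where
  "flip_set A B X Y u = insert u (path_state A B X Y (flip_time A B X u))"

text \<open>Vertices of the current bag outside the larger end of the transition: those of
  \<open>X\<close> already removed and those of \<open>Y\<close> not yet inserted. They may be
  adjacent to one another, so the encoding omits them.\<close>

definition bag_rest where
  "bag_rest A B X Y u =
     {w\<in>sym_diff X Y. A w \<le> flip_time A B X u \<and> flip_time A B X u \<le> B w} - flip_set A B X Y u"

definition encoding where
  "encoding A B X Y u = (sym_diff X Y - flip_set A B X Y u - bag_rest A B X Y u) \<union> (X \<inter> Y)"

section \<open>A single canonical path and its states\<close>

locale canonical_path =
  fixes G :: "('a, 'b) pre_digraph" and p :: nat and A B :: "'a \<Rightarrow> nat" and X Y :: "'a set"
  assumes graph: "graph G" and ind_X: "independent_in G X" and ind_Y: "independent_in G Y"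
    and schedule: "interval_schedule (arcs_ends G) (p + 1) (sym_diff X Y) A B"
begin

sublocale graph G by (rule graph)

abbreviation "state \<equiv> path_state A B X Y"
abbreviation "\<tau> \<equiv> flip_time A B X"
abbreviation "M \<equiv> flip_set A B X Y"
abbreviation "S \<equiv> bag_rest A B X Y"
abbreviation "W \<equiv> encoding A B X Y"

lemma finite_XY: "finite X" "finite Y"
  using ind_X ind_Y finite_subset[OF _ finite_verts] by (auto simp: independent_in_def)

lemma XY_verts: "X \<subseteq> verts G" "Y \<subseteq> verts G"
  using ind_X ind_Y by (auto simp: independent_in_def)

lemma schedule_facts:
  "inj_on A (sym_diff X Y)" "inj_on B (sym_diff X Y)" "A ` sym_diff X Y \<inter> B ` sym_diff X Y = {}"
  "\<forall>u\<in>sym_diff X Y. A u < B u"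
  "\<forall>u\<in>sym_diff X Y. \<forall>v\<in>sym_diff X Y. (u, v) \<in> arcs_ends G \<longrightarrow> A u < B v"
  "\<forall>t. card {u\<in>sym_diff X Y. A u \<le> t \<and> t \<le> B u} \<le> p + 1"
  using schedule unfolding interval_schedule_def by - (elim conjE, assumption)+

lemmas inj_A = inj_onD[OF schedule_facts(1)]
lemmas inj_B = inj_onD[OF schedule_facts(2)]
lemmas A_less_B = bspec[OF schedule_facts(4)]
lemmas A_less_B_adj = mp[OF bspec[OF bspec[OF schedule_facts(5)]]]
lemmas card_bag = spec[OF schedule_facts(6)]

lemma A_neq_B: "u \<in> sym_diff X Y \<Longrightarrow> v \<in> sym_diff X Y \<Longrightarrow> A u \<noteq> B v"
  using schedule_facts(3) by (metis disjoint_iff imageI)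

lemma inj_on_flip_time: "inj_on \<tau> (sym_diff X Y)"
  by (rule inj_onI) (metis A_neq_B flip_time_def inj_A inj_B)

text \<open>An edge inside \<open>X \<union> Y\<close> can only run between \<open>X - Y\<close> and
  \<open>Y - X\<close>, since any other pair lies in \<open>X\<close> or in
  \<open>Y\<close>.\<close>

lemma independent_union_subset:
  assumes "Z \<subseteq> X \<union> Y"
    and "\<And>u v. u \<in> X - Y \<Longrightarrow> v \<in> Y - X \<Longrightarrow> u \<in> Z \<Longrightarrow> v \<in> Z \<Longrightarrow> (u, v) \<notin> arcs_ends G"
  shows "independent_in G Z"
  unfolding independent_in_def
proof (intro conjI ballI)
  show "Z \<subseteq> verts G" using assms(1) XY_verts by blast
  fix u v assume uv: "u \<in> Z" "v \<in> Z"
  then consider "u \<in> X" "v \<in> X" | "u \<in> Y" "v \<in> Y" | "u \<in> X - Y" "v \<in> Y - X" | "u \<in> Y - X" "v \<in> X - Y"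
    using assms(1) by blast
  then show "(u, v) \<notin> arcs_ends G"
  proof cases
    case 4
    then show ?thesis using assms(2)[of v u] uv graph_symmetric by blast
  qed (use assms(2) uv ind_X ind_Y in \<open>auto simp: independent_in_def\<close>)
qed

text \<open>\<open>state t\<close> is the set just before the event at time \<open>t\<close>. The
  larger end of a removal is therefore the earlier state, that of an insertion the later one;
  distinct event times ensure that only \<open>u\<close> changes.\<close>

lemma flip_set_remove:
  assumes "u \<in> X - Y"
  shows "M u = state (\<tau> u)" "M u - {u} = state (Suc (\<tau> u))"
proof -
  have [simp]: "\<tau> u = A u" "u \<in> X" "u \<notin> Y" using assms by (auto simp: flip_time_def)
  show "M u = state (\<tau> u)" by (auto simp: flip_set_def path_state_def)
  have "Suc (A u) \<le> A w \<longleftrightarrow> A u \<le> A w \<and> w \<noteq> u" if "w \<in> X" "w \<notin> Y" for w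
    using inj_A[of w u] that by (auto simp: Suc_le_eq order_le_less)
  moreover have "B w < Suc (A u) \<longleftrightarrow> B w < A u" if "w \<in> Y" "w \<notin> X" for w
    using A_neq_B[of u w] that by (auto simp: less_Suc_eq)
  ultimately show "M u - {u} = state (Suc (\<tau> u))"
    by (auto simp: flip_set_def path_state_def)
qed

lemma flip_set_insert:
  assumes "u \<in> Y - X"
  shows "M u = state (Suc (\<tau> u))" "M u - {u} = state (\<tau> u)"
proof -
  have [simp]: "\<tau> u = B u" "u \<in> Y" "u \<notin> X" using assms by (auto simp: flip_time_def)
  show "M u - {u} = state (\<tau> u)" by (auto simp: flip_set_def path_state_def)
  have "B w < Suc (B u) \<longleftrightarrow> B w < B u \<or> w = u" if "w \<in> Y" "w \<notin> X" for w
    using inj_B[of w u] that by (auto simp: less_Suc_eq)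
  moreover have "Suc (B u) \<le> A w \<longleftrightarrow> B u \<le> A w" if "w \<in> X" "w \<notin> Y" for w
    using A_neq_B[of w u] that by (auto simp: Suc_le_eq order_le_less)
  ultimately show "M u = state (Suc (\<tau> u))"
    by (auto simp: flip_set_def path_state_def)
qed

text \<open>A vertex of \<open>Y\<close> enters only after its neighbours in \<open>X\<close> have
  left: otherwise \<open>t \<le> A u < B v < t\<close>.\<close>

lemma independent_state: "independent_in G (state t)"
proof -
  have key: "(u, v) \<notin> arcs_ends G" if "u \<in> X - Y" "v \<in> Y - X" "u \<in> state t" "v \<in> state t" for u v
  proof
    assume "(u, v) \<in> arcs_ends G"
    then have "A u < B v" using A_less_B_adj that by simp
    moreover have "t \<le> A u" "B v < t" using that by (auto simp: path_state_def)
    ultimately show False by simp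
  qed
  have "state t \<subseteq> X \<union> Y" by (auto simp: path_state_def)
  then show ?thesis using independent_union_subset key by blast
qed

lemma independent_flip_set: "u \<in> sym_diff X Y \<Longrightarrow> independent_in G (M u)"
  using flip_set_remove(1) flip_set_insert(1) independent_state by (metis Un_iff)

text \<open>Telescoping along the path, which makes one flip per vertex of the symmetric difference,
  followed by Cauchy-Schwarz.\<close>

lemma square_diff_le_path_sum:
  fixes f :: "'a set \<Rightarrow> real"
  shows "(f X - f Y)\<^sup>2 \<le> real (card (sym_diff X Y)) * (\<Sum>u\<in>sym_diff X Y. (f (M u) - f (M u - {u}))\<^sup>2)"
proof -
  let ?U = "sym_diff X Y"
  have finU: "finite ?U" using finite_XY by simp
  \<comment> \<open>A time after all events, when the path has arrived at \<open>Y\<close>.\<close>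
  define T where "T = Suc (\<Sum>u\<in>?U. A u + B u)"
  have T: "A u < T" "B u < T" if "u \<in> ?U" for u
    using member_le_sum[of u ?U "\<lambda>u. A u + B u"] that finU unfolding T_def by auto
  have "state 0 = X" by (auto simp: path_state_def)
  moreover have "state T = Y"
    using T by (auto simp: path_state_def) (meson not_le)+
  moreover define g where "g t = f (state t) - f (state (Suc t))" for t
  ultimately have "f X - f Y = (\<Sum>t<T. g t)"
    unfolding g_def using sum_lessThan_telescope'[of "\<lambda>t. f (state t)" T] by simp
  \<comment> \<open>Times without an event leave the state unchanged.\<close>
  also have "\<dots> = (\<Sum>t\<in>\<tau> ` ?U. g t)"
  proof (rule sum.mono_neutral_right)
    show "\<tau> ` ?U \<subseteq> {..<T}" using T by (auto simp: flip_time_def)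
    show "\<forall>t\<in>{..<T} - \<tau> ` ?U. g t = 0"
    proof
      fix t assume "t \<in> {..<T} - \<tau> ` ?U"
      then have no: "\<tau> u \<noteq> t" if "u \<in> ?U" for u using that by blast
      have "A u \<noteq> t" if "u \<in> X" "u \<notin> Y" for u using no[of u] that by (auto simp: flip_time_def)
      moreover have "B u \<noteq> t" if "u \<in> Y" "u \<notin> X" for u using no[of u] that by (auto simp: flip_time_def)
      ultimately have "state (Suc t) = state t"
        by (auto simp: path_state_def Suc_le_eq less_Suc_eq order_le_less)
      then show "g t = 0" by (simp add: g_def)
    qed
  qed simp
  also have "\<dots> = (\<Sum>u\<in>?U. g (\<tau> u))" by (simp add: sum.reindex[OF inj_on_flip_time])
  finally have "(f X - f Y)\<^sup>2 = (\<Sum>u\<in>?U. g (\<tau> u))\<^sup>2" by simp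
  also have "\<dots> \<le> (\<Sum>u\<in>?U. (g (\<tau> u))\<^sup>2) * real (card ?U)" by (rule sum_squared_le_sum_of_squares)
  also have "(\<Sum>u\<in>?U. (g (\<tau> u))\<^sup>2) = (\<Sum>u\<in>?U. (f (M u) - f (M u - {u}))\<^sup>2)"
  proof (rule sum.cong[OF refl])
    fix u assume "u \<in> ?U"
    then consider "u \<in> X - Y" | "u \<in> Y - X" by blast
    then show "(g (\<tau> u))\<^sup>2 = (f (M u) - f (M u - {u}))\<^sup>2"
      by cases (simp_all add: g_def power2_commute flip: flip_set_remove flip_set_insert)
  qed
  finally show ?thesis by (simp add: mult.commute)
qed

section \<open>Encoding and decoding of a transition\<close>

lemma bag_rest_subset: "S u \<subseteq> sym_diff X Y"
  by (auto simp: bag_rest_def)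

text \<open>The bag at the flip time of \<open>u\<close> has at most \<open>p + 1\<close> vertices,
  and one of them is \<open>u\<close>, which lies in \<open>M u\<close>.\<close>

lemma card_bag_rest:
  assumes "u \<in> sym_diff X Y"
  shows "card (S u) \<le> p"
proof -
  let ?C = "{w\<in>sym_diff X Y. A w \<le> \<tau> u \<and> \<tau> u \<le> B w}"
  have u: "u \<in> ?C" using A_less_B[OF assms] assms by (auto simp: flip_time_def)
  have fin: "finite ?C" using finite_XY by auto
  have "S u \<subseteq> ?C - {u}" by (auto simp: bag_rest_def flip_set_def)
  then have "card (S u) \<le> card (?C - {u})" using fin by (intro card_mono) auto
  also have "\<dots> \<le> p" using card_bag[of "\<tau> u"] u fin by simp
  finally show ?thesis .
qed

text \<open>In \<open>W u\<close>, a vertex of \<open>X - Y\<close> has its interval entirely before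
  the flip and a vertex of \<open>Y - X\<close> entirely after it; disjoint intervals exclude
  adjacency.\<close>

lemma independent_encoding:
  assumes "u \<in> sym_diff X Y"
  shows "independent_in G (W u)"
proof -
  have key: "(v, w) \<notin> arcs_ends G"
    if vw: "v \<in> X - Y" "w \<in> Y - X" "v \<in> W u" "w \<in> W u" for v w
  proof
    assume "(v, w) \<in> arcs_ends G"
    then have "(w, v) \<in> arcs_ends G" using graph_symmetric by blast
    then have less: "A w < B v" using A_less_B_adj[of w v] vw by auto
    have v: "v \<notin> M u" "v \<notin> S u" and w: "w \<notin> M u" "w \<notin> S u" using vw by (auto simp: encoding_def)
    from v vw have "\<not> \<tau> u \<le> A v" by (auto simp: flip_set_def path_state_def)
    moreover from w vw have "\<not> B w < \<tau> u" by (auto simp: flip_set_def path_state_def)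
    ultimately have "B v < \<tau> u" "\<tau> u < A w"
      using v w vw by (auto simp: bag_rest_def)
    with less show False by simp
  qed
  have "W u \<subseteq> X \<union> Y" by (auto simp: encoding_def)
  then show ?thesis using independent_union_subset key by blast
qed

text \<open>\<open>M u\<close>, \<open>W u\<close> and \<open>S u\<close> cover the symmetric
  difference once and \<open>X \<inter> Y\<close> twice. Hence the weights of the three sets
  multiply to those of \<open>X\<close> and \<open>Y\<close>.\<close>

lemma card_flip_set_encoding:
  assumes "u \<in> sym_diff X Y"
  shows "card X + card Y = card (M u) + card (W u) + card (S u)"
proof -
  let ?U = "sym_diff X Y" and ?I = "X \<inter> Y"
  have fin: "finite ?U" "finite ?I" using finite_XY by auto
  have M: "M u = ?I \<union> (M u \<inter> ?U)" using assms by (auto simp: flip_set_def path_state_def)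
  have "card (M u) = card ?I + card (M u \<inter> ?U)"
    by (subst M, rule card_Un_disjoint) (use fin in auto)
  moreover have "card (W u) = card (?U - M u - S u) + card ?I"
    unfolding encoding_def by (rule card_Un_disjoint) (use fin in auto)
  moreover have "card X = card ?I + card (X - Y)" "card Y = card ?I + card (Y - X)"
    using finite_XY card_Int_Diff[of X Y] card_Int_Diff[of Y X] by (auto simp: Int_commute)
  moreover have "card ?U = card (X - Y) + card (Y - X)"
    by (rule card_Un_disjoint) (use finite_XY in auto)
  moreover have "card ?U = card (?U \<inter> M u) + card (?U - M u)" using fin by (intro card_Int_Diff)
  moreover have "card (?U - M u) = card ((?U - M u) \<inter> S u) + card (?U - M u - S u)"
    using fin by (intro card_Int_Diff) auto
  moreover have "(?U - M u) \<inter> S u = S u" by (auto simp: bag_rest_def)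
  ultimately show ?thesis by (simp add: Int_commute)
qed

lemma flip_set_Int_encoding: "u \<in> sym_diff X Y \<Longrightarrow> M u \<inter> W u = X \<inter> Y"
  by (auto simp: encoding_def flip_set_def path_state_def)

lemma sym_diff_flip_set_encoding:
  assumes "u \<in> sym_diff X Y"
  shows "sym_diff (M u) (W u) \<union> S u = sym_diff X Y"
proof -
  have "M u \<subseteq> X \<union> Y" "X \<inter> Y \<subseteq> M u" "S u \<subseteq> sym_diff X Y" "S u \<inter> M u = {}"
    using assms by (auto simp: flip_set_def path_state_def bag_rest_def)
  then show ?thesis unfolding encoding_def by blast
qed

text \<open>Decoding \<open>X\<close>: before its interval, \<open>w\<close> is in the state iff it
  belongs to \<open>X\<close>, and after it iff it does not. Inside the bag,
  \<open>S u \<inter> X\<close> and the bit \<open>u \<in> X\<close> supply the answer.\<close>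

lemma mem_X_iff:
  assumes u: "u \<in> sym_diff X Y" and w: "w \<in> sym_diff X Y"
  shows "w \<in> X \<longleftrightarrow> (if w \<in> S u then w \<in> S u \<inter> X
            else if A w \<le> \<tau> u \<and> \<tau> u \<le> B w then u \<in> X else if B w < \<tau> u then w \<notin> M u else w \<in> M u)"
proof -
  have AB: "A w < B w" "A u < B u" using A_less_B u w by auto
  have memM: "w \<in> M u \<longleftrightarrow> (if w \<in> X then \<tau> u \<le> A w else B w < \<tau> u)" if "w \<noteq> u"
    using w that by (auto simp: flip_set_def path_state_def)
  have \<tau>: "\<tau> u = (if u \<in> X then A u else B u)" by (simp add: flip_time_def)
  consider "w \<in> S u" | "w \<notin> S u" "w = u" | "w \<notin> S u" "w \<noteq> u" "A w \<le> \<tau> u" "\<tau> u \<le> B w"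
    | "w \<notin> S u" "w \<noteq> u" "\<not> (A w \<le> \<tau> u \<and> \<tau> u \<le> B w)" by blast
  then show ?thesis
  proof cases
    \<comment> \<open>Such a \<open>w\<close> is in \<open>M u\<close>, which forces
      \<open>w \<in> X\<close> and \<open>A w = \<tau> u\<close>. The flip time is then a value of
      \<open>A\<close>, so \<open>u \<in> X\<close> and both sides are true.\<close>
    case 3
    then have "w \<in> M u" using w by (auto simp: bag_rest_def)
    with 3 have "w \<in> X" "\<tau> u = A w" using memM by (auto split: if_splits)
    moreover from this have "u \<in> X" using A_neq_B[OF w u] \<tau> by (auto split: if_splits)
    ultimately show ?thesis using 3 by simp
  next
    case 4
    then show ?thesis using memM AB by auto
  qed (use AB \<tau> in auto)
qed

end

section \<open>Congestion of the canonical paths\<close>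

locale hardcore_model = graph G for G :: "('a, 'b) pre_digraph" +
  fixes lam :: real
  assumes lam_pos: "0 < lam" and verts_ne: "verts G \<noteq> {}"
begin

abbreviation "\<I> \<equiv> indep_sets_of G"
abbreviation "V \<equiv> verts G"
abbreviation "n \<equiv> card V"
abbreviation "\<alpha> \<equiv> independence_number G"
abbreviation "Z \<equiv> hardcore_partition G lam"
abbreviation "wt X \<equiv> lam ^ card X"

lemma mem_indep: "X \<in> \<I> \<longleftrightarrow> independent_in G X"
  by (simp add: indep_sets_of_def)

lemma indep_subset_verts: "X \<in> \<I> \<Longrightarrow> X \<subseteq> V"
  by (simp add: mem_indep independent_in_def)

lemma finite_indep: "X \<in> \<I> \<Longrightarrow> finite X"
  using indep_subset_verts finite_subset[OF _ finite_verts] by blast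

lemma indep_mono: "X \<in> \<I> \<Longrightarrow> X' \<subseteq> X \<Longrightarrow> X' \<in> \<I>"
  unfolding mem_indep independent_in_def by blast

lemma empty_indep: "{} \<in> \<I>"
  by (simp add: mem_indep independent_in_def)

lemma finite_indep_sets: "finite \<I>"
  by (rule finite_subset[of _ "Pow V"]) (auto dest: indep_subset_verts)

lemma card_le_independence_number: "X \<in> \<I> \<Longrightarrow> card X \<le> \<alpha>"
  unfolding independence_number_def using finite_indep_sets by (intro Max_ge) auto

lemma wt_pos: "0 < wt X"
  using lam_pos by simp

lemma partition_pos: "0 < Z"
  unfolding hardcore_partition_def
  using finite_indep_sets empty_indep wt_pos by (intro sum_pos) auto

text \<open>The Dirichlet form without normalisation. Each transition is counted once, at its larger
  end \<open>M\<close>; the rate enters in \<open>ip_diff_heat\<close>.\<close>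

definition dirichlet :: "('a set \<Rightarrow> real) \<Rightarrow> real" where
  "dirichlet f = (\<Sum>M\<in>\<I>. \<Sum>u\<in>M. wt M * (f M - f (M - {u}))\<^sup>2)"

text \<open>
  The base \<open>2 * lam\<close> counts, for each vertex missing from the encoding, whether it lies in \<open>X\<close>
  or in \<open>Y\<close>.
\<close>

definition small_sets_weight :: "nat \<Rightarrow> real" where
  "small_sets_weight p = (\<Sum>S | S \<subseteq> V \<and> card S \<le> p. (2 * lam) ^ card S)"

text \<open>The schedule depends on the pair only through \<open>sym_diff X Y\<close>, which makes
  decoding possible: transition, encoding and deleted set give the symmetric difference, this gives
  the schedule, and with the recorded bits \<open>X\<close> and \<open>Y\<close> follow. The factor
  4 is 2 for the path length \<open>2 * \<alpha>\<close> and 2 for the direction of the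
  flip.\<close>

lemma canonical_path_sum:
  assumes sched: "\<And>X Y. X \<in> \<I> \<Longrightarrow> Y \<in> \<I> \<Longrightarrow>
      interval_schedule (arcs_ends G) (p + 1) (sym_diff X Y) (A (sym_diff X Y)) (B (sym_diff X Y))"
  shows "(\<Sum>X\<in>\<I>. \<Sum>Y\<in>\<I>. wt X * wt Y * (f X - f Y)\<^sup>2)
    \<le> 4 * real \<alpha> * Z * small_sets_weight p * dirichlet f"
proof -
  define \<A> where "\<A> X Y = A (sym_diff X Y)" for X Y
  define \<B> where "\<B> X Y = B (sym_diff X Y)" for X Y
  define M where "M X Y u = flip_set (\<A> X Y) (\<B> X Y) X Y u" for X Y u
  define W where "W X Y u = encoding (\<A> X Y) (\<B> X Y) X Y u" for X Y u
  define S where "S X Y u = bag_rest (\<A> X Y) (\<B> X Y) X Y u" for X Y u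
  define D where "D N u = (f N - f (N - {u}))\<^sup>2" for N u
  have path: "canonical_path G p (\<A> X Y) (\<B> X Y) X Y" if "X \<in> \<I>" "Y \<in> \<I>" for X Y
    using sched[OF that] that graph_axioms unfolding canonical_path_def \<A>_def \<B>_def mem_indep by simp
  let ?T = "SIGMA X:\<I>. SIGMA Y:\<I>. sym_diff X Y"
  \<comment> \<open>The \<open>bool\<close> records \<open>u \<in> X\<close>, that is, whether the
    flip removes or inserts \<open>u\<close>.\<close>
  let ?E = "(SIGMA N:\<I>. N) \<times> (UNIV :: bool set)"
  let ?S = "SIGMA R:{R. R \<subseteq> V \<and> card R \<le> p}. Pow R"
  have fin: "finite ?T" "finite ?E" "finite ?S"
    using finite_indep_sets finite_indep finite_subset[OF _ finite_verts] by (auto intro!: finite_SigmaI)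
  define \<phi> where "\<phi> = (\<lambda>(X, Y, u). (((M X Y u, u), u \<in> X), W X Y u, S X Y u, S X Y u \<inter> X))"
  define h where "h = (\<lambda>(((N, u), d :: bool), W :: 'a set, R :: 'a set, L :: 'a set). (wt N * D N u) * (wt W * lam ^ card R))"
  have inj: "inj_on \<phi> ?T"
  proof (rule inj_onI)
    fix x x' assume x: "x \<in> ?T" "x' \<in> ?T" and eq: "\<phi> x = \<phi> x'"
    obtain X Y u X' Y' u' where xx: "x = (X, Y, u)" "x' = (X', Y', u')" by (metis prod_cases3)
    from x xx have mem: "X \<in> \<I>" "Y \<in> \<I>" "u \<in> sym_diff X Y" "X' \<in> \<I>" "Y' \<in> \<I>" "u' \<in> sym_diff X' Y'" by auto
    interpret P: canonical_path G p "\<A> X Y" "\<B> X Y" X Y by (rule path) fact+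
    interpret P': canonical_path G p "\<A> X' Y'" "\<B> X' Y'" X' Y' by (rule path) fact+
    from eq xx have e: "M X Y u = M X' Y' u'" "u = u'" "u \<in> X \<longleftrightarrow> u' \<in> X'" "W X Y u = W X' Y' u'"
      "S X Y u = S X' Y' u'" "S X Y u \<inter> X = S X' Y' u' \<inter> X'" by (auto simp: \<phi>_def)
    have U: "sym_diff X Y = sym_diff X' Y'"
      using P.sym_diff_flip_set_encoding[OF mem(3)] P'.sym_diff_flip_set_encoding[OF mem(6)] e
      unfolding M_def W_def S_def by (simp only:)
    then have AB: "\<A> X Y = \<A> X' Y'" "\<B> X Y = \<B> X' Y'" by (simp_all only: \<A>_def \<B>_def)
    have I: "X \<inter> Y = X' \<inter> Y'"
      using P.flip_set_Int_encoding[OF mem(3)] P'.flip_set_Int_encoding[OF mem(6)] e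
      unfolding M_def W_def S_def by (simp only:)
    have "w \<in> X \<longleftrightarrow> w \<in> X'" if w: "w \<in> sym_diff X Y" for w
    proof -
      have w': "w \<in> sym_diff X' Y'" using w U by (simp only:)
      have "flip_time (\<A> X Y) (\<B> X Y) X u = flip_time (\<A> X' Y') (\<B> X' Y') X' u'"
        using AB e by (simp add: flip_time_def)
      then show ?thesis
        using P.mem_X_iff[OF mem(3) w] P'.mem_X_iff[OF mem(6) w'] e AB
        unfolding M_def W_def S_def by (simp only:)
    qed
    then have "X = X' \<and> Y = Y'" using U I by blast
    then show "x = x'" using e xx by simp
  qed
  have im: "\<phi> ` ?T \<subseteq> ?E \<times> \<I> \<times> ?S"
  proof
    fix y assume "y \<in> \<phi> ` ?T"
    then obtain X Y u where y: "y = \<phi> (X, Y, u)" and mem: "X \<in> \<I>" "Y \<in> \<I>" "u \<in> sym_diff X Y" by auto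
    interpret P: canonical_path G p "\<A> X Y" "\<B> X Y" X Y by (rule path) fact+
    have "M X Y u \<in> \<I>" "W X Y u \<in> \<I>"
      using P.independent_flip_set[OF mem(3)] P.independent_encoding[OF mem(3)]
      by (simp_all add: M_def W_def mem_indep)
    moreover have "u \<in> M X Y u" by (simp add: M_def flip_set_def)
    moreover have "S X Y u \<subseteq> V" "card (S X Y u) \<le> p"
      using P.bag_rest_subset[of u] P.card_bag_rest[OF mem(3)] P.XY_verts by (auto simp: S_def)
    ultimately show "y \<in> ?E \<times> \<I> \<times> ?S" unfolding y by (simp add: \<phi>_def)
  qed
  have weight: "wt X * wt Y * D (M X Y u) u = h (\<phi> (X, Y, u))"
    if mem: "X \<in> \<I>" "Y \<in> \<I>" "u \<in> sym_diff X Y" for X Y u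
  proof -
    interpret P: canonical_path G p "\<A> X Y" "\<B> X Y" X Y by (rule path) fact+
    have "wt X * wt Y = wt (M X Y u) * wt (W X Y u) * lam ^ card (S X Y u)"
      using P.card_flip_set_encoding[OF mem(3)] unfolding M_def W_def S_def
      by (simp flip: power_add)
    then show ?thesis by (simp add: h_def \<phi>_def)
  qed
  have "(\<Sum>X\<in>\<I>. \<Sum>Y\<in>\<I>. wt X * wt Y * (f X - f Y)\<^sup>2)
      \<le> (\<Sum>X\<in>\<I>. \<Sum>Y\<in>\<I>. \<Sum>u\<in>sym_diff X Y. 2 * real \<alpha> * h (\<phi> (X, Y, u)))"
  proof (intro sum_mono)
    fix X Y assume mem: "X \<in> \<I>" "Y \<in> \<I>"
    interpret P: canonical_path G p "\<A> X Y" "\<B> X Y" X Y by (rule path) fact+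
    have "card (sym_diff X Y) \<le> card (X - Y) + card (Y - X)" by (rule card_Un_le)
    also have "\<dots> \<le> card X + card Y" using finite_indep mem by (intro add_mono card_mono) auto
    also have "\<dots> \<le> 2 * \<alpha>" using card_le_independence_number mem by (metis add_mono mult_2)
    finally have len: "real (card (sym_diff X Y)) \<le> 2 * real \<alpha>" by linarith
    have "(f X - f Y)\<^sup>2 \<le> real (card (sym_diff X Y)) * (\<Sum>u\<in>sym_diff X Y. D (M X Y u) u)"
      using P.square_diff_le_path_sum[of f] by (simp only: D_def M_def)
    also have "\<dots> \<le> 2 * real \<alpha> * (\<Sum>u\<in>sym_diff X Y. D (M X Y u) u)"
      using len by (intro mult_right_mono sum_nonneg) (auto simp: D_def)
    finally have "wt X * wt Y * (f X - f Y)\<^sup>2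
        \<le> wt X * wt Y * (2 * real \<alpha> * (\<Sum>u\<in>sym_diff X Y. D (M X Y u) u))"
      using wt_pos[of X] wt_pos[of Y] by (intro mult_left_mono) auto
    also have "\<dots> = (\<Sum>u\<in>sym_diff X Y. 2 * real \<alpha> * (wt X * wt Y * D (M X Y u) u))"
      by (simp add: sum_distrib_left mult_ac)
    also have "\<dots> = (\<Sum>u\<in>sym_diff X Y. 2 * real \<alpha> * h (\<phi> (X, Y, u)))"
      using weight[OF mem] by (intro sum.cong refl) (simp only:)
    finally show "wt X * wt Y * (f X - f Y)\<^sup>2 \<le> \<dots>" .
  qed
  also have "\<dots> = (\<Sum>X\<in>\<I>. \<Sum>(Y, u)\<in>(SIGMA Y:\<I>. sym_diff X Y). 2 * real \<alpha> * h (\<phi> (X, Y, u)))"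
    using finite_indep_sets finite_indep by (intro sum.cong refl sum.Sigma) auto
  also have "\<dots> = (\<Sum>(X, Y, u)\<in>?T. 2 * real \<alpha> * h (\<phi> (X, Y, u)))"
    using finite_indep_sets finite_indep by (intro sum.Sigma) (auto intro!: finite_SigmaI)
  also have "\<dots> = (\<Sum>x\<in>?T. 2 * real \<alpha> * h (\<phi> x))"
    by (intro sum.cong) auto
  also have "\<dots> = 2 * real \<alpha> * sum h (\<phi> ` ?T)"
    by (simp add: sum.reindex[OF inj] sum_distrib_left)
  \<comment> \<open>By injectivity each code occurs at most once, so the sum may be extended to all
    codes. It then factorises over transition, encoding and deleted set.\<close>
  also have "\<dots> \<le> 2 * real \<alpha> * sum h (?E \<times> \<I> \<times> ?S)"
    using fin finite_indep_sets im lam_pos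
    by (intro mult_left_mono sum_mono2) (auto simp: h_def D_def intro!: mult_nonneg_nonneg)
  also have "sum h (?E \<times> \<I> \<times> ?S)
      = (\<Sum>((N, u), d)\<in>?E. wt N * D N u) * (\<Sum>(W, R, L)\<in>\<I> \<times> ?S. wt W * lam ^ card R)"
    unfolding sum_product sum.cartesian_product h_def by (rule sum.cong) auto
  also have "(\<Sum>(W, R, L)\<in>\<I> \<times> ?S. wt W * lam ^ card R) = Z * (\<Sum>(R, L)\<in>?S. lam ^ card R)"
    unfolding hardcore_partition_def sum_product sum.cartesian_product by (rule sum.cong) auto
  also have "(\<Sum>(R, L)\<in>?S. lam ^ card R) = small_sets_weight p"
  proof -
    have "(\<Sum>(R, L)\<in>?S. lam ^ card R) = (\<Sum>R | R \<subseteq> V \<and> card R \<le> p. \<Sum>L\<in>Pow R. lam ^ card R)"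
      using finite_subset[OF _ finite_verts] by (intro sum.Sigma[symmetric]) auto
    also have "\<dots> = small_sets_weight p"
      unfolding small_sets_weight_def using finite_subset[OF _ finite_verts]
      by (intro sum.cong refl) (auto simp: card_Pow power_mult_distrib)
    finally show ?thesis .
  qed
  also have "(\<Sum>((N, u), d)\<in>?E. wt N * D N u) = 2 * dirichlet f"
  proof -
    have "(\<Sum>((N, u), d)\<in>?E. wt N * D N u) = (\<Sum>(y, d)\<in>?E. case y of (N, u) \<Rightarrow> wt N * D N u)"
      by (simp add: case_prod_beta)
    also have "\<dots> = (\<Sum>y\<in>(SIGMA N:\<I>. N). \<Sum>d\<in>(UNIV :: bool set). case y of (N, u) \<Rightarrow> wt N * D N u)"
      by (rule sum.cartesian_product[symmetric])
    also have "\<dots> = 2 * (\<Sum>(N, u)\<in>(SIGMA N:\<I>. N). wt N * D N u)"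
      by (simp add: sum_distrib_left case_prod_beta)
    also have "(\<Sum>(N, u)\<in>(SIGMA N:\<I>. N). wt N * D N u) = dirichlet f"
      unfolding dirichlet_def D_def using finite_indep_sets finite_indep by (intro sum.Sigma[symmetric]) auto
    finally show ?thesis .
  qed
  finally show ?thesis by (simp add: mult_ac)
qed

section \<open>The transition operator\<close>

definition ip :: "('a set \<Rightarrow> real) \<Rightarrow> ('a set \<Rightarrow> real) \<Rightarrow> real" where
  "ip f g = (\<Sum>X\<in>\<I>. wt X * f X * g X)"

text \<open>The heat bath at \<open>v\<close>, a conditional expectation given the rest of the
  state. Writing \<open>insert v X\<close> and \<open>X - {v}\<close> makes the formula the same
  whether or not \<open>v\<close> is occupied.\<close>

definition resample :: "'a \<Rightarrow> ('a set \<Rightarrow> real) \<Rightarrow> 'a set \<Rightarrow> real" where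
  "resample v f X =
     (if insert v X \<in> \<I> then (lam * f (insert v X) + f (X - {v})) / (1 + lam) else f X)"

definition heat :: "('a set \<Rightarrow> real) \<Rightarrow> 'a set \<Rightarrow> real" where
  "heat f X = (\<Sum>v\<in>V. resample v f X) / real n"

lemma n_pos: "0 < real n"
  using verts_ne by (simp add: card_gt_0_iff)

lemma ip_commute: "ip f g = ip g f"
  by (simp add: ip_def mult_ac)

lemma ip_cong: "(\<And>X. X \<in> \<I> \<Longrightarrow> f X = f' X) \<Longrightarrow> (\<And>X. X \<in> \<I> \<Longrightarrow> g X = g' X) \<Longrightarrow> ip f g = ip f' g'"
  by (simp add: ip_def)

lemma ip_self_nonneg: "0 \<le> ip f f"
  unfolding ip_def using lam_pos by (intro sum_nonneg) (simp add: mult.assoc)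

lemma resample_diff_const: "resample v (\<lambda>X. f X - c) X = resample v f X - c"
  using lam_pos by (simp add: resample_def field_simps)

lemma heat_diff_const: "heat (\<lambda>X. f X - c) X = heat f X - c"
  using verts_ne by (simp add: heat_def resample_diff_const sum_subtractf diff_divide_distrib)

lemma resample_resample:
  "resample v (resample v f) X = resample v f X"
proof (cases "insert v X \<in> \<I>")
  case True
  have "insert v (X - {v}) = insert v X" by auto
  with True have "resample v f (insert v X) = resample v f X" "resample v f (X - {v}) = resample v f X"
    by (auto simp: resample_def)
  then have "resample v (resample v f) X = (lam * resample v f X + resample v f X) / (1 + lam)"
    using True by (simp add: resample_def[of v "resample v f"])
  also have "\<dots> = resample v f X" using lam_pos by (simp add: field_simps)
  finally show ?thesis .
qed (simp add: resample_def)

section \<open>Single-vertex updates as orthogonal projections\<close>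

definition addable :: "'a \<Rightarrow> 'a set set" where
  "addable v = {X\<in>\<I>. v \<notin> X \<and> insert v X \<in> \<I>}"

definition blocked :: "'a \<Rightarrow> 'a set set" where
  "blocked v = {X\<in>\<I>. insert v X \<notin> \<I>}"

lemma inj_on_insert_addable: "inj_on (insert v) (addable v)"
  by (rule inj_onI) (auto simp: addable_def)

lemma insert_image_addable: "insert v ` addable v = {X\<in>\<I>. v \<in> X}"
proof
  show "{X\<in>\<I>. v \<in> X} \<subseteq> insert v ` addable v"
  proof
    fix X assume X: "X \<in> {X\<in>\<I>. v \<in> X}"
    then have "X = insert v (X - {v})" by auto
    moreover from this X have "X - {v} \<in> addable v"
      using indep_mono[of X "X - {v}"] by (simp add: addable_def insert_absorb)
    ultimately show "X \<in> insert v ` addable v" by blast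
  qed
qed (auto simp: addable_def)

text \<open>The update at \<open>v\<close> mixes \<open>X\<close> with \<open>insert v X\<close> for
  addable \<open>X\<close> and fixes every blocked set.\<close>

lemma sum_indep_split:
  fixes g :: "'a set \<Rightarrow> real"
  shows "sum g \<I> = (\<Sum>X\<in>addable v. g X + g (insert v X)) + sum g (blocked v)"
proof -
  have fin: "finite (addable v)" "finite (blocked v)"
    using finite_indep_sets by (auto simp: addable_def blocked_def)
  have I: "\<I> = (addable v \<union> insert v ` addable v) \<union> blocked v"
    unfolding insert_image_addable by (auto simp: addable_def blocked_def insert_absorb)
  have "sum g \<I> = sum g (addable v \<union> insert v ` addable v) + sum g (blocked v)"
    by (subst I, rule sum.union_disjoint) (use fin in \<open>auto simp: addable_def blocked_def\<close>)
  also have "sum g (addable v \<union> insert v ` addable v) = sum g (addable v) + sum g (insert v ` addable v)"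
    by (rule sum.union_disjoint) (use fin in \<open>auto simp: addable_def\<close>)
  also have "sum g (insert v ` addable v) = (\<Sum>X\<in>addable v. g (insert v X))"
    by (simp add: sum.reindex[OF inj_on_insert_addable])
  finally show ?thesis by (simp add: sum.distrib)
qed

lemma addableD:
  assumes "X \<in> addable v"
  shows "X \<in> \<I>" "v \<notin> X" "insert v X \<in> \<I>" "X - {v} = X" "wt (insert v X) = lam * wt X"
    "resample v f X = (lam * f (insert v X) + f X) / (1 + lam)"
    "resample v f (insert v X) = (lam * f (insert v X) + f X) / (1 + lam)"
  using assms finite_indep by (auto simp: addable_def resample_def)

lemma blocked_resample: "X \<in> blocked v \<Longrightarrow> resample v f X = f X"
  by (simp add: blocked_def resample_def)

text \<open>A pair \<open>X\<close>, \<open>insert v X\<close> has total weight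
  \<open>wt X * (1 + lam)\<close> and a common value after the update. The resulting formula is
  symmetric in \<open>f\<close> and \<open>g\<close>, which gives self-adjointness.\<close>

lemma ip_resample:
  "ip f (resample v g) = (\<Sum>X\<in>addable v. wt X * (1 + lam) * resample v f X * resample v g X)
     + (\<Sum>X\<in>blocked v. wt X * f X * g X)"
proof -
  have "wt X * f X * resample v g X + wt (insert v X) * f (insert v X) * resample v g (insert v X)
      = wt X * (1 + lam) * resample v f X * resample v g X" if "X \<in> addable v" for X
    using lam_pos unfolding addableD(5-7)[OF that] by (simp add: field_simps)
  then show ?thesis
    unfolding ip_def sum_indep_split[of _ v] by (simp add: blocked_resample)
qed

lemma ip_resample_commute: "ip f (resample v g) = ip (resample v f) g"
  unfolding ip_commute[of "resample v f" g] ip_resample by (simp add: mult_ac)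

text \<open>Self-adjoint and idempotent means orthogonal projection; the positivity of
  \<open>heat\<close> comes from here.\<close>

lemma ip_resample_eq: "ip f (resample v g) = ip (resample v f) (resample v g)"
  by (metis (no_types, lifting) ip_cong ip_resample_commute resample_resample)

text \<open>On each pair the loss is the variance of two values with weights 1 and
  \<open>lam\<close>, times the total weight of the pair.\<close>

lemma ip_diff_resample:
  "ip f f - ip f (resample v f) = (\<Sum>X\<in>addable v. lam * wt X * (f (insert v X) - f X)\<^sup>2) / (1 + lam)"
proof -
  have "wt X * f X * f X + wt (insert v X) * f (insert v X) * f (insert v X)
      - wt X * (1 + lam) * resample v f X * resample v f X
      = lam * wt X * (f (insert v X) - f X)\<^sup>2 / (1 + lam)" if X: "X \<in> addable v" for X
  proof -
    define a b where "a = f X" and "b = f (insert v X)"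
    have "a * a + lam * b * b - (1 + lam) * ((lam * b + a) / (1 + lam)) * ((lam * b + a) / (1 + lam))
      = lam * (b - a)\<^sup>2 / (1 + lam)"
      using lam_pos by (simp add: divide_simps power2_eq_square) (simp add: algebra_simps)
    then have "wt X * (a * a + lam * b * b - (1 + lam) * ((lam * b + a) / (1 + lam)) * ((lam * b + a) / (1 + lam)))
      = wt X * (lam * (b - a)\<^sup>2 / (1 + lam))" by (simp only:)
    then show ?thesis
      unfolding addableD(5-7)[OF X] a_def b_def by (simp add: algebra_simps)
  qed
  then show ?thesis
    unfolding ip_resample unfolding ip_def sum_indep_split[of _ v]
    by (simp add: sum_subtractf[symmetric] sum_divide_distrib)
qed

text \<open>An addable pair is one transition with larger end \<open>M = insert v X\<close>, whose
  weight is \<open>lam * wt X\<close>.\<close>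

lemma sum_addable_eq_dirichlet:
  "(\<Sum>v\<in>V. \<Sum>X\<in>addable v. lam * wt X * (f (insert v X) - f X)\<^sup>2) = dirichlet f"
proof -
  define D where "D M u = wt M * (f M - f (M - {u}))\<^sup>2" for M u
  have "dirichlet f = (\<Sum>M\<in>\<I>. \<Sum>u\<in>V. if u \<in> M then D M u else 0)"
    unfolding dirichlet_def D_def
  proof (rule sum.cong[OF refl])
    fix M assume "M \<in> \<I>"
    then have "M = {u\<in>V. u \<in> M}" using indep_subset_verts by blast
    then have "(\<Sum>u\<in>M. wt M * (f M - f (M - {u}))\<^sup>2) = (\<Sum>u\<in>{u\<in>V. u \<in> M}. wt M * (f M - f (M - {u}))\<^sup>2)"
      by simp
    also have "\<dots> = (\<Sum>u\<in>V. if u \<in> M then wt M * (f M - f (M - {u}))\<^sup>2 else 0)"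
      by (rule sum.inter_filter) simp
    finally show "(\<Sum>u\<in>M. wt M * (f M - f (M - {u}))\<^sup>2) = \<dots>" .
  qed
  also have "\<dots> = (\<Sum>u\<in>V. \<Sum>M\<in>\<I>. if u \<in> M then D M u else 0)" by (rule sum.swap)
  also have "\<dots> = (\<Sum>u\<in>V. \<Sum>M\<in>insert u ` addable u. D M u)"
    unfolding insert_image_addable by (simp add: sum.inter_filter[OF finite_indep_sets])
  also have "\<dots> = (\<Sum>u\<in>V. \<Sum>X\<in>addable u. D (insert u X) u)"
    by (simp add: sum.reindex[OF inj_on_insert_addable])
  also have "\<dots> = (\<Sum>v\<in>V. \<Sum>X\<in>addable v. lam * wt X * (f (insert v X) - f X)\<^sup>2)"
    by (intro sum.cong refl) (simp add: D_def addableD(2,4,5))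
  finally show ?thesis by simp
qed

section \<open>Dirichlet form and Cauchy-Schwarz for the averaged operator\<close>

lemma ip_heat: "ip f (heat g) = (\<Sum>v\<in>V. ip f (resample v g)) / real n"
proof -
  have "ip f (heat g) = (\<Sum>X\<in>\<I>. \<Sum>v\<in>V. wt X * f X * resample v g X) / real n"
    by (simp add: ip_def heat_def sum_distrib_left sum_divide_distrib)
  also have "\<dots> = (\<Sum>v\<in>V. ip f (resample v g)) / real n"
    unfolding ip_def by (subst sum.swap) simp
  finally show ?thesis .
qed

lemma ip_heat_commute: "ip f (heat g) = ip (heat f) g"
  unfolding ip_commute[of "heat f" g] ip_heat
  by (intro arg_cong[where f = "\<lambda>x. x / real n"] sum.cong refl) (metis ip_resample_commute ip_commute)

lemma ip_diff_heat: "ip f f - ip f (heat f) = dirichlet f / (real n * (1 + lam))"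
proof -
  have "ip f f - ip f (heat f) = (\<Sum>v\<in>V. ip f f - ip f (resample v f)) / real n"
    using verts_ne by (simp add: ip_heat sum_subtractf diff_divide_distrib)
  also have "\<dots> = dirichlet f / (1 + lam) / real n"
    unfolding ip_diff_resample sum_divide_distrib[symmetric] sum_addable_eq_dirichlet by simp
  finally show ?thesis by (simp add: mult.commute)
qed

lemma ip_heat_self_nonneg: "0 \<le> ip f (heat f)"
  unfolding ip_heat ip_resample_eq[of f _ f] by (intro divide_nonneg_nonneg sum_nonneg ip_self_nonneg) simp

text \<open>Since every update is a projection, \<open>ip f (heat g)\<close> is, up to
  \<open>1 / n\<close>, an ordinary scalar product of vectors indexed by vertex and state.\<close>

lemma ip_heat_Cauchy_Schwarz: "(ip f (heat g))\<^sup>2 \<le> ip f (heat f) * ip g (heat g)"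
proof -
  define F where "F f x = (case x of (v, X) \<Rightarrow> sqrt (wt X) * resample v f X)" for f x
  have eq: "ip f (heat g) = (\<Sum>x\<in>V \<times> \<I>. F f x * F g x) / real n" for f g
  proof -
    have "(\<Sum>x\<in>V \<times> \<I>. F f x * F g x) = (\<Sum>v\<in>V. \<Sum>X\<in>\<I>. F f (v, X) * F g (v, X))"
      by (simp add: sum.cartesian_product case_prod_beta)
    also have "\<dots> = (\<Sum>v\<in>V. ip (resample v f) (resample v g))"
    proof -
      have "F f (v, X) * F g (v, X) = wt X * resample v f X * resample v g X" for v X
      proof -
        have "F f (v, X) * F g (v, X) = (sqrt (wt X) * sqrt (wt X)) * resample v f X * resample v g X"
          unfolding F_def prod.case by (simp only: mult_ac)
        also have "sqrt (wt X) * sqrt (wt X) = wt X" using lam_pos by simp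
        finally show ?thesis .
      qed
      then show ?thesis by (simp add: ip_def)
    qed
    finally show ?thesis unfolding ip_heat ip_resample_eq[of f _ g] by simp
  qed
  have "(\<Sum>x\<in>V \<times> \<I>. F f x * F g x)\<^sup>2 \<le> (\<Sum>x\<in>V \<times> \<I>. (F f x)\<^sup>2) * (\<Sum>x\<in>V \<times> \<I>. (F g x)\<^sup>2)"
    by (rule Cauchy_Schwarz_ineq_sum)
  then show ?thesis
    unfolding eq using n_pos by (simp add: power_divide power2_eq_square divide_right_mono)
qed

section \<open>Contraction on functions of mean zero\<close>

definition mean_zero :: "('a set \<Rightarrow> real) \<Rightarrow> bool" where
  "mean_zero f \<longleftrightarrow> (\<Sum>X\<in>\<I>. wt X * f X) = 0"

text \<open>\<open>heat\<close> is self-adjoint and fixes constants.\<close>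

lemma mean_zero_heat:
  assumes "mean_zero f"
  shows "mean_zero (heat f)"
proof -
  have "resample v (\<lambda>_. 1) X = 1" for v X
    using lam_pos by (simp add: resample_def add.commute)
  then have one: "heat (\<lambda>_. 1) X = 1" for X
    using verts_ne by (simp add: heat_def)
  have "(\<Sum>X\<in>\<I>. wt X * heat f X) = ip (\<lambda>_. 1) (heat f)" by (simp add: ip_def)
  also have "\<dots> = ip (heat (\<lambda>_. 1)) f" by (rule ip_heat_commute)
  also have "\<dots> = (\<Sum>X\<in>\<I>. wt X * f X)" by (simp add: ip_def one)
  finally show ?thesis using assms by (simp add: mean_zero_def)
qed

lemma variance_eq:
  assumes "mean_zero f"
  shows "(\<Sum>X\<in>\<I>. \<Sum>Y\<in>\<I>. wt X * wt Y * (f X - f Y)\<^sup>2) = 2 * Z * ip f f"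
proof -
  have "(\<Sum>X\<in>\<I>. \<Sum>Y\<in>\<I>. wt X * wt Y * (f X - f Y)\<^sup>2)
     = (\<Sum>X\<in>\<I>. \<Sum>Y\<in>\<I>. (wt X * f X * f X) * wt Y + wt X * (wt Y * f Y * f Y) - 2 * ((wt X * f X) * (wt Y * f Y)))"
    by (intro sum.cong refl) (simp add: power2_eq_square algebra_simps)
  also have "\<dots> = ip f f * Z + Z * ip f f - 2 * ((\<Sum>X\<in>\<I>. wt X * f X) * (\<Sum>Y\<in>\<I>. wt Y * f Y))"
    unfolding ip_def hardcore_partition_def sum_product
    by (simp add: sum.distrib sum_subtractf sum_distrib_left)
  finally show ?thesis using assms by (simp add: mean_zero_def)
qed

text \<open>From the quadratic form to the norm: Cauchy-Schwarz for the positive form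
  \<open>ip f (heat g)\<close>, applied to \<open>f\<close> and \<open>heat f\<close>, bounds
  \<open>a * a\<close> by \<open>(q * ip f f) * (q * a)\<close>, and one factor \<open>a\<close>
  cancels.\<close>

lemma heat_contraction:
  assumes gap: "\<And>f. mean_zero f \<Longrightarrow> ip f (heat f) \<le> q * ip f f" and q: "0 \<le> q"
    and f: "mean_zero f"
  shows "ip (heat f) (heat f) \<le> q\<^sup>2 * ip f f"
proof -
  define a where "a = ip (heat f) (heat f)"
  have a0: "0 \<le> a" unfolding a_def by (rule ip_self_nonneg)
  have "a\<^sup>2 = (ip f (heat (heat f)))\<^sup>2" by (simp add: a_def ip_heat_commute)
  also have "\<dots> \<le> ip f (heat f) * ip (heat f) (heat (heat f))" by (rule ip_heat_Cauchy_Schwarz)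
  also have "\<dots> \<le> (q * ip f f) * (q * a)"
    unfolding a_def using gap[OF f] gap[OF mean_zero_heat[OF f]] q
    by (intro mult_mono ip_heat_self_nonneg mult_nonneg_nonneg ip_self_nonneg)
  finally have le: "a * a \<le> (q\<^sup>2 * ip f f) * a" by (simp add: power2_eq_square mult_ac)
  have "a \<le> q\<^sup>2 * ip f f"
  proof (cases "a = 0")
    case True
    then show ?thesis using ip_self_nonneg[of f] by simp
  next
    case False
    then show ?thesis using a0 mult_right_le_imp_le[OF le] by simp
  qed
  then show ?thesis by (simp add: a_def)
qed

section \<open>Evolution of the chain's distribution\<close>

abbreviation "K \<equiv> glauber_step G lam"

text \<open>If \<open>v\<close> may be occupied, the step makes it occupied with probability
  \<open>lam / (1 + lam)\<close> and vacant otherwise, whatever its present status; this is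
  \<open>resample v\<close>.\<close>

lemma pmf_glauber_step:
  assumes X: "X \<in> \<I>"
  shows "pmf (K X) Y = heat (indicator {Y}) X"
proof -
  have r: "0 \<le> 1 / (1 + lam)" "1 / (1 + lam) \<le> 1" "0 \<le> lam / (1 + lam)" "lam / (1 + lam) \<le> 1"
    using lam_pos by simp_all
  have c: "1 - 1 / (1 + lam) = lam / (1 + lam)" "1 - lam / (1 + lam) = 1 / (1 + lam)"
    using lam_pos by (simp_all add: field_simps)
  have "pmf (K X) Y = (\<Sum>v\<in>V. pmf (if v \<in> X then
         map_pmf (\<lambda>b. if b then X - {v} else X) (bernoulli_pmf (1 / (1 + lam)))
       else if independent_in G (insert v X) then
         map_pmf (\<lambda>b. if b then insert v X else X) (bernoulli_pmf (lam / (1 + lam)))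
       else return_pmf X) Y) / real n"
    unfolding glauber_step_def using verts_ne by (simp add: pmf_bind_pmf_of_set)
  also have "\<dots> = heat (indicator {Y}) X"
    unfolding heat_def
  proof (rule arg_cong[where f = "\<lambda>x. x / real n"], rule sum.cong[OF refl])
    fix v assume "v \<in> V"
    consider "v \<in> X" | "v \<notin> X" "insert v X \<in> \<I>" | "v \<notin> X" "insert v X \<notin> \<I>" by blast
    then show "pmf (if v \<in> X then
         map_pmf (\<lambda>b. if b then X - {v} else X) (bernoulli_pmf (1 / (1 + lam)))
       else if independent_in G (insert v X) then
         map_pmf (\<lambda>b. if b then insert v X else X) (bernoulli_pmf (lam / (1 + lam)))
       else return_pmf X) Y = resample v (indicator {Y}) X"
      using X r c
      by cases (auto simp: resample_def mem_indep insert_absorb map_pmf_def pmf_bind indicator_def add_divide_distrib)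
  qed
  finally show ?thesis .
qed

lemma set_glauber_step:
  assumes X: "X \<in> \<I>"
  shows "set_pmf (K X) \<subseteq> \<I>"
  unfolding glauber_step_def using X indep_mono[OF X] verts_ne
  by (auto simp: mem_indep split: if_splits)

lemma set_chain: "set_pmf (chain_dist K {} t) \<subseteq> \<I>"
proof (induction t)
  case (Suc t)
  then show ?case using set_glauber_step by fastforce
qed (simp add: empty_indep)

text \<open>The density of the chain with respect to \<open>hardcore G lam\<close>, minus 1, all
  divided by \<open>Z\<close>.\<close>

definition rel_density :: "nat \<Rightarrow> 'a set \<Rightarrow> real" where
  "rel_density t X = pmf (chain_dist K {} t) X / wt X - 1 / Z"

text \<open>Reversibility: self-adjointness moves \<open>heat\<close> from the indicator to the
  density, so densities evolve under \<open>heat\<close> itself.\<close>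

lemma rel_density_Suc:
  assumes Y: "Y \<in> \<I>"
  shows "rel_density (Suc t) Y = heat (rel_density t) Y"
proof -
  define h where "h X = pmf (chain_dist K {} t) X / wt X" for X
  have "pmf (chain_dist K {} (Suc t)) Y = (\<Sum>X\<in>\<I>. pmf (K X) Y * pmf (chain_dist K {} t) X)"
    using set_chain finite_indep_sets
    by (simp add: pmf_bind) (subst integral_measure_pmf_real[of \<I>], auto)
  also have "\<dots> = ip h (heat (indicator {Y}))"
    unfolding ip_def using lam_pos by (intro sum.cong refl) (simp add: pmf_glauber_step h_def mult.commute)
  also have "\<dots> = ip (heat h) (indicator {Y})" by (rule ip_heat_commute)
  also have "\<dots> = (\<Sum>X\<in>{Y}. wt X * heat h X * indicator {Y} X)"
    unfolding ip_def using Y finite_indep_sets by (intro sum.mono_neutral_right) (auto simp: indicator_def)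
  finally have "pmf (chain_dist K {} (Suc t)) Y / wt Y = heat h Y" using lam_pos by simp
  moreover have "rel_density t = (\<lambda>X. h X - 1 / Z)" by (simp add: rel_density_def h_def fun_eq_iff)
  ultimately show ?thesis by (simp add: rel_density_def heat_diff_const)
qed

lemma wt_rel_density: "wt X * rel_density t X = pmf (chain_dist K {} t) X - hardcore G lam X"
  using lam_pos by (simp add: rel_density_def hardcore_def field_simps)

lemma mean_zero_rel_density: "mean_zero (rel_density t)"
proof -
  have "(\<Sum>X\<in>\<I>. pmf (chain_dist K {} t) X) = 1"
    using set_chain finite_indep_sets by (intro sum_pmf_eq_1)
  moreover have "(\<Sum>X\<in>\<I>. hardcore G lam X) = 1"
    using partition_pos unfolding hardcore_def by (simp add: hardcore_partition_def flip: sum_divide_distrib)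
  ultimately show ?thesis by (simp add: mean_zero_def wt_rel_density sum_subtractf)
qed

text \<open>Mean zero removes the part coming from \<open>1 / Z\<close>. Only the empty set remains,
  with weight 1 and value \<open>1 - 1 / Z\<close>.\<close>

lemma ip_rel_density_0: "ip (rel_density 0) (rel_density 0) \<le> 1"
proof -
  have "ip (rel_density 0) (rel_density 0) = (\<Sum>X\<in>\<I>. wt X * rel_density 0 X * (indicator {{}} X / wt X)) - (\<Sum>X\<in>\<I>. wt X * rel_density 0 X) / Z"
  proof -
    have "rel_density 0 X = indicator {{}} X / wt X - 1 / Z" for X
      by (simp add: rel_density_def indicator_def)
    then have "wt X * rel_density 0 X * rel_density 0 X
        = wt X * rel_density 0 X * (indicator {{}} X / wt X - 1 / Z)" for X
      by (rule arg_cong)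
    then show ?thesis
      unfolding ip_def sum_divide_distrib sum_subtractf[symmetric] by (simp add: right_diff_distrib)
  qed
  also have "\<dots> = (\<Sum>X\<in>\<I>. wt X * rel_density 0 X * (indicator {{}} X / wt X))"
    using mean_zero_rel_density[of 0] by (simp add: mean_zero_def)
  also have "\<dots> = (\<Sum>X\<in>{{}}. wt X * rel_density 0 X * (indicator {{}} X / wt X))"
    using empty_indep finite_indep_sets by (intro sum.mono_neutral_right) (auto simp: indicator_def)
  also have "\<dots> \<le> 1" using partition_pos by (simp add: rel_density_def)
  finally show ?thesis .
qed

lemma ip_rel_density_le:
  assumes gap: "\<And>f. mean_zero f \<Longrightarrow> ip f (heat f) \<le> q * ip f f" and q: "0 \<le> q"
  shows "ip (rel_density t) (rel_density t) \<le> (q ^ t)\<^sup>2"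
proof (induction t)
  case 0
  then show ?case using ip_rel_density_0 by simp
next
  case (Suc t)
  have "ip (rel_density (Suc t)) (rel_density (Suc t)) = ip (heat (rel_density t)) (heat (rel_density t))"
    by (intro ip_cong rel_density_Suc)
  also have "\<dots> \<le> q\<^sup>2 * ip (rel_density t) (rel_density t)"
    using gap q mean_zero_rel_density by (rule heat_contraction)
  also have "\<dots> \<le> q\<^sup>2 * (q ^ t)\<^sup>2" using Suc by (intro mult_left_mono) auto
  finally show ?case by (simp add: power_mult_distrib)
qed

text \<open>Cauchy-Schwarz passes from the L1 distance to the weighted L2 norm at the cost of the
  root of the total weight.\<close>

lemma total_variation_le:
  assumes gap: "\<And>f. mean_zero f \<Longrightarrow> ip f (heat f) \<le> q * ip f f" and q: "0 \<le> q"
  shows "(\<Sum>X\<in>\<I>. \<bar>pmf (chain_dist K {} t) X - hardcore G lam X\<bar>) \<le> sqrt Z * q ^ t"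
proof -
  let ?g = "rel_density t"
  have sq: "sqrt (wt X) * sqrt (wt X) = wt X" for X using wt_pos[of X] by simp
  have "(\<Sum>X\<in>\<I>. \<bar>pmf (chain_dist K {} t) X - hardcore G lam X\<bar>) = (\<Sum>X\<in>\<I>. sqrt (wt X) * (sqrt (wt X) * \<bar>?g X\<bar>))"
    using lam_pos by (intro sum.cong refl) (simp add: wt_rel_density[symmetric] abs_mult sq flip: mult.assoc)
  also have "\<dots> \<le> sqrt (Z * (q ^ t)\<^sup>2)"
  proof (rule real_le_rsqrt)
    have "(\<Sum>X\<in>\<I>. sqrt (wt X) * (sqrt (wt X) * \<bar>?g X\<bar>))\<^sup>2
        \<le> (\<Sum>X\<in>\<I>. (sqrt (wt X))\<^sup>2) * (\<Sum>X\<in>\<I>. (sqrt (wt X) * \<bar>?g X\<bar>)\<^sup>2)"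
      by (rule Cauchy_Schwarz_ineq_sum)
    also have "(\<Sum>X\<in>\<I>. (sqrt (wt X))\<^sup>2) = Z"
      using lam_pos by (simp add: hardcore_partition_def)
    also have "(\<Sum>X\<in>\<I>. (sqrt (wt X) * \<bar>?g X\<bar>)\<^sup>2) = ip ?g ?g"
      unfolding ip_def using lam_pos
      by (intro sum.cong refl) (simp add: power_mult_distrib, simp add: power2_eq_square)
    also have "Z * ip ?g ?g \<le> Z * (q ^ t)\<^sup>2"
      using ip_rel_density_le[OF gap q] partition_pos by (intro mult_left_mono) auto
    finally show "(\<Sum>X\<in>\<I>. sqrt (wt X) * (sqrt (wt X) * \<bar>?g X\<bar>))\<^sup>2 \<le> Z * (q ^ t)\<^sup>2" .
  qed
  also have "\<dots> = sqrt Z * q ^ t" using q by (simp add: real_sqrt_mult)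
  finally show ?thesis .
qed

end

section \<open>Mixing time\<close>

lemma sum_small_subsets:
  assumes "finite V"
  shows "(\<Sum>S | S \<subseteq> V \<and> card S \<le> m. x ^ card S) = (\<Sum>k\<le>m. of_nat (card V choose k) * x ^ k :: 'b :: comm_semiring_1)"
proof -
  let ?F = "\<lambda>k. {S. S \<subseteq> V \<and> card S = k}"
  have "{S. S \<subseteq> V \<and> card S \<le> m} = (\<Union>k\<le>m. ?F k)" by auto
  moreover have "(\<Sum>S\<in>(\<Union>k\<le>m. ?F k). x ^ card S) = (\<Sum>k\<le>m. \<Sum>S\<in>?F k. x ^ card S)"
    using assms by (intro sum.UNION_disjoint) auto
  ultimately show ?thesis by (simp add: n_subsets[OF assms])
qed

lemma sum_small_subsets_le:
  fixes x :: real
  assumes "finite V" "0 \<le> x"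
  shows "(\<Sum>S | S \<subseteq> V \<and> card S \<le> m. x ^ card S) \<le> (\<Sum>k\<le>m. (real (card V) * x) ^ k / fact k)"
  unfolding sum_small_subsets[OF assms(1)]
proof (rule sum_mono)
  fix k
  have "real ((card V choose k) * fact k) \<le> real (card V ^ k)"
    using binomial_fact_pow by (simp only: of_nat_le_iff)
  then have "real (card V choose k) \<le> real (card V) ^ k / fact k"
    by (simp add: pos_le_divide_eq)
  then have "real (card V choose k) * x ^ k \<le> real (card V) ^ k / fact k * x ^ k"
    using assms(2) by (intro mult_right_mono) auto
  then show "real (card V choose k) * x ^ k \<le> (real (card V) * x) ^ k / fact k"
    by (simp add: power_mult_distrib)
qed

lemma two_power_le_fact: "2 ^ k \<le> 2 * (fact k :: real)"
proof (induction k)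
  case (Suc k)
  show ?case
  proof (cases k)
    case (Suc j)
    have "2 * 2 ^ k \<le> 2 * (2 * (fact k :: real))" using Suc.IH by simp
    also have "\<dots> \<le> real (Suc k) * (2 * fact k)" using Suc by (intro mult_right_mono) auto
    finally show ?thesis by (simp add: algebra_simps)
  qed simp
qed simp

text \<open>Since \<open>2 ^ k / fact k\<close> is at most 2, a new term adds at most
  \<open>2 * y ^ Suc m\<close>, while \<open>5 \<le> y\<close> turns the old bound into
  \<open>1 / 2 * y ^ Suc m\<close>. So 5/2 reproduces itself; being at most \<open>exp 1\<close>, it
  becomes the factor e of the final bound.\<close>

lemma sum_two_power_fact_le:
  fixes y :: real
  assumes y: "5 \<le> y"
  shows "(\<Sum>k\<le>m. (2 * y) ^ k / fact k) \<le> 5 / 2 * y ^ m"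
proof (induction m)
  case (Suc m)
  have "(2 * y) ^ Suc m / fact (Suc m) = 2 ^ Suc m / fact (Suc m) * y ^ Suc m"
    by (simp add: power_mult_distrib)
  also have "\<dots> \<le> 2 * y ^ Suc m"
    using two_power_le_fact[of "Suc m"] y by (intro mult_right_mono) (auto simp: pos_divide_le_eq simp del: fact_Suc power_Suc)
  finally have "(\<Sum>k\<le>Suc m. (2 * y) ^ k / fact k) \<le> 5 / 2 * y ^ m + 2 * y ^ Suc m"
    unfolding sum.atMost_Suc using Suc.IH by (rule add_mono[rotated])
  also have "5 / 2 * y ^ m \<le> 1 / 2 * (y * y ^ m)" using y by simp
  finally show ?case by simp
qed simp

lemma exp_1_ge: "5 / 2 \<le> exp (1 :: real)"
  using exp_lower_Taylor_quadratic[of 1] by simp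

lemma exp_9_ge: "5 \<le> exp (9 :: real)"
  using exp_ge_add_one_self[of 9] by linarith

section \<open>Relaxation and mixing time of the hardcore model\<close>

context hardcore_model
begin

lemma independence_number_pos: "1 \<le> \<alpha>"
proof -
  obtain v where "v \<in> V" using verts_ne by blast
  then have "{v} \<in> \<I>" using adj_not_same by (auto simp: mem_indep independent_in_def)
  from card_le_independence_number[OF this] show ?thesis by simp
qed

lemma small_sets_weight_le:
  assumes "5 \<le> real n * lam"
  shows "small_sets_weight p \<le> exp 1 * (real n * lam) ^ p"
proof -
  have "small_sets_weight p \<le> (\<Sum>k\<le>p. (2 * (real n * lam)) ^ k / fact k)"
    using sum_small_subsets_le[OF finite_verts, of "2 * lam" p] lam_pos
    by (simp add: small_sets_weight_def mult_ac)
  also have "\<dots> \<le> 5 / 2 * (real n * lam) ^ p" using assms by (rule sum_two_power_fact_le)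
  also have "\<dots> \<le> exp 1 * (real n * lam) ^ p" using exp_1_ge assms by (intro mult_right_mono) auto
  finally show ?thesis .
qed

text \<open>Independent sets have size at most \<open>\<alpha>\<close>, so the subset estimate with
  cutoff \<open>\<alpha>\<close> applies. Its logarithm is the source of the last factor of
  \<open>mixing_bound\<close>.\<close>

lemma partition_le:
  assumes "5 \<le> real n * lam"
  shows "Z \<le> exp (real \<alpha> * ln (real n * lam) + 1)"
proof -
  have "Z \<le> small_sets_weight \<alpha>"
  proof -
    have "Z \<le> (\<Sum>S | S \<subseteq> V \<and> card S \<le> \<alpha>. lam ^ card S)"
      unfolding hardcore_partition_def
      using indep_subset_verts card_le_independence_number lam_pos finite_verts by (intro sum_mono2) auto
    also have "\<dots> \<le> small_sets_weight \<alpha>"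
      unfolding small_sets_weight_def using lam_pos by (intro sum_mono power_mono) auto
    finally show ?thesis .
  qed
  also have "\<dots> \<le> exp 1 * (real n * lam) ^ \<alpha>" by (rule small_sets_weight_le[OF assms])
  also have "\<dots> = exp (real \<alpha> * ln (real n * lam) + 1)"
    using assms by (simp add: exp_add exp_of_nat_mult mult.commute)
  finally show ?thesis .
qed

definition relaxation_bound :: "nat \<Rightarrow> real" where
  "relaxation_bound p = 2 * exp 1 * real \<alpha> * real n ^ (p + 1) * lam ^ p * (1 + max lam (1 / lam))"

lemma dirichlet_nonneg: "0 \<le> dirichlet f"
  unfolding dirichlet_def using lam_pos by (intro sum_nonneg) auto

text \<open>The value 2 keeps the contraction factor nonnegative and later pays for rounding the
  number of steps.\<close>

lemma relaxation_bound_ge: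
  assumes "5 \<le> real n * lam"
  shows "2 \<le> relaxation_bound p"
proof -
  have "1 * 1 * 1 * 1 * 1 \<le> exp 1 * real \<alpha> * real n * (real n * lam) ^ p * (1 + max lam (1 / lam))"
    using assms independence_number_pos n_pos lam_pos
    by (intro mult_mono one_le_power mult_nonneg_nonneg) (auto simp: max_def)
  also have "2 * \<dots> = relaxation_bound p"
    by (simp add: relaxation_bound_def power_mult_distrib mult_ac)
  finally show ?thesis by simp
qed

lemma poincare:
  assumes pw: "bipartite_pathwidth G \<le> int p" and big: "5 \<le> real n * lam" and f: "mean_zero f"
  shows "ip f (heat f) \<le> (1 - 1 / relaxation_bound p) * ip f f"
proof -
  let ?R = "relaxation_bound p"
  define sched where "sched U = (\<lambda>(A, B). interval_schedule (arcs_ends G) (p + 1) U A B)" for U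
  \<comment> \<open>One schedule is chosen per vertex set, not per pair, as the decoding in
    \<open>canonical_path_sum\<close> requires.\<close>
  define AB where "AB U = (SOME ab. sched U ab)" for U
  have "interval_schedule (arcs_ends G) (p + 1) (sym_diff X Y) (fst (AB (sym_diff X Y))) (snd (AB (sym_diff X Y)))"
    if XY: "X \<in> \<I>" "Y \<in> \<I>" for X Y
  proof -
    obtain A B where "sched (sym_diff X Y) (A, B)"
      using bipartite_pathwidth_imp_schedule[OF graph_axioms pw XY[unfolded mem_indep]]
      unfolding sched_def by auto
    then have "sched (sym_diff X Y) (AB (sym_diff X Y))" unfolding AB_def by (rule someI)
    then show ?thesis by (simp add: sched_def case_prod_beta)
  qed
  from canonical_path_sum[where A = "\<lambda>U. fst (AB U)" and B = "\<lambda>U. snd (AB U)", OF this, of f]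
  have "2 * Z * ip f f \<le> 4 * real \<alpha> * Z * small_sets_weight p * dirichlet f"
    unfolding variance_eq[OF f] .
  then have "(2 * Z) * ip f f \<le> (2 * Z) * (2 * real \<alpha> * small_sets_weight p * dirichlet f)"
    by (simp add: mult_ac)
  then have "ip f f \<le> 2 * real \<alpha> * small_sets_weight p * dirichlet f"
    using partition_pos by (simp add: mult_ac)
  also have "\<dots> \<le> 2 * real \<alpha> * (exp 1 * (real n * lam) ^ p) * dirichlet f"
    using small_sets_weight_le[OF big] dirichlet_nonneg by (intro mult_left_mono mult_right_mono) auto
  also have "\<dots> = 2 * real \<alpha> * (exp 1 * (real n * lam) ^ p) * (real n * (1 + lam)) * (ip f f - ip f (heat f))"
  proof -
    have "dirichlet f = (real n * (1 + lam)) * (ip f f - ip f (heat f))"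
      using ip_diff_heat[of f] verts_ne lam_pos by simp
    then show ?thesis by (simp only: mult.assoc)
  qed
  also have "\<dots> = (2 * exp 1 * real \<alpha> * real n ^ (p + 1) * lam ^ p) * (1 + lam) * (ip f f - ip f (heat f))"
    by (simp add: power_mult_distrib mult_ac)
  also have "\<dots> \<le> ?R * (ip f f - ip f (heat f))"
    unfolding relaxation_bound_def ip_diff_heat using dirichlet_nonneg[of f] lam_pos
    by (intro mult_right_mono mult_left_mono) auto
  finally have "ip f f / ?R \<le> ip f f - ip f (heat f)"
    using relaxation_bound_ge[OF big, of p] by (simp add: pos_divide_le_eq mult.commute)
  then show ?thesis by (simp add: left_diff_distrib)
qed

lemma glauber_mixing_time_le:
  assumes pw: "bipartite_pathwidth G \<le> int p" and big: "5 \<le> real n * lam" and eps: "0 < \<epsilon>"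
  shows "ereal_of_enat (glauber_mixing_time G lam {} \<epsilon>) \<le> ereal (max 0 (mixing_bound p n \<alpha> lam \<epsilon>))"
proof -
  define R where "R = relaxation_bound p"
  define A where "A = real \<alpha> * ln (real n * lam) + 1"
  define T where "T = mixing_bound p n \<alpha> lam \<epsilon>"
  \<comment> \<open>Rounding down keeps \<open>t\<close> within the bound and loses at most one step
    against \<open>T\<close>; a negative \<open>T\<close> gives \<open>t = 0\<close>.\<close>
  define t where "t = nat \<lfloor>max 0 T\<rfloor>"
  define q where "q = 1 - 1 / R"
  have R: "2 \<le> R" unfolding R_def by (rule relaxation_bound_ge[OF big])
  have T: "T = R * (A + ln (1 / \<epsilon>))"
    by (simp add: T_def R_def A_def mixing_bound_def relaxation_bound_def)
  have A: "1 \<le> A" using big unfolding A_def by simp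
  have t: "real t \<le> max 0 T" "T - 1 \<le> real t" unfolding t_def by linarith+
  have q0: "0 \<le> q" using R by (simp add: q_def)
  have "q \<le> exp (- (1 / R))" using exp_ge_add_one_self[of "- (1 / R)"] by (simp add: q_def)
  then have "q ^ t \<le> exp (- (1 / R)) ^ t" using q0 by (rule power_mono)
  also have "\<dots> = exp (- (real t / R))" by (simp flip: exp_of_nat_mult)
  finally have qt: "q ^ t \<le> exp (- (real t / R))" .
  have "(T - 1) / R \<le> real t / R" using t R by (intro divide_right_mono) auto
  moreover have "(T - 1) / R = A + ln (1 / \<epsilon>) - 1 / R" using R by (simp add: T diff_divide_distrib)
  moreover have "1 / R \<le> 1 / 2" using R by simp
  \<comment> \<open>\<open>sqrt Z\<close> costs \<open>A / 2\<close> while \<open>T / R\<close>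
    contains a full \<open>A\<close>. The spare half is at least 1/2 and absorbs the
    \<open>1 / R\<close> lost by rounding.\<close>
  ultimately have "A / 2 - real t / R \<le> ln \<epsilon>" using A eps by (simp add: ln_div)
  then have exponent: "exp (A / 2 - real t / R) \<le> \<epsilon>" using eps by (metis exp_le_cancel_iff exp_ln)
  have "(exp (A / 2))\<^sup>2 = exp A" by (simp flip: exp_double)
  then have "Z \<le> (exp (A / 2))\<^sup>2" using partition_le[OF big] by (simp add: A_def)
  then have Z: "sqrt Z \<le> exp (A / 2)" by (intro real_le_lsqrt) auto
  have "(\<Sum>X\<in>\<I>. \<bar>pmf (chain_dist K {} t) X - hardcore G lam X\<bar>) \<le> sqrt Z * q ^ t"
    using poincare[OF pw big] q0 unfolding q_def R_def by (rule total_variation_le)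
  also have "\<dots> \<le> exp (A / 2) * exp (- (real t / R))"
    using Z qt q0 partition_pos by (intro mult_mono) auto
  also have "\<dots> \<le> \<epsilon>" using exponent by (simp flip: exp_add)
  finally have "1 / 2 * (\<Sum>X\<in>\<I>. \<bar>pmf (chain_dist K {} t) X - hardcore G lam X\<bar>) \<le> \<epsilon>"
    using eps by simp
  then have "glauber_mixing_time G lam {} \<epsilon> \<le> enat t"
    unfolding glauber_mixing_time_def mixing_time_def by (intro Inf_lower) blast
  then have "ereal_of_enat (glauber_mixing_time G lam {} \<epsilon>) \<le> ereal_of_enat (enat t)"
    by (simp only: ereal_of_enat_le_iff)
  also have "\<dots> \<le> ereal (max 0 T)" using t(1) by (simp del: ereal_max)
  finally show ?thesis unfolding T_def .
qed

end

section \<open>Polynomial growth of the bound, and the theorem\<close>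

lemma mixing_bound_le_polynomial:
  fixes lam \<epsilon> :: real
  assumes n: "1 \<le> n" and a: "a \<le> n" and lam: "exp 9 / real n \<le> lam" and eps: "0 < \<epsilon>"
  shows "mixing_bound p n a lam \<epsilon>
    \<le> 8 * exp 1 * real n ^ (p + 4) * max lam (1 / lam) ^ (p + 2) * (1 + max 0 (ln (1 / \<epsilon>)))"
proof -
  define m where "m = max lam (1 / lam)"
  define L where "L = max 0 (ln (1 / \<epsilon>))"
  define N where "N = real n"
  have N: "1 \<le> N" using n by (simp add: N_def)
  have lam0: "0 < lam" using lam n by (smt (verit) divide_pos_pos exp_gt_zero of_nat_0_less_iff less_le_trans zero_less_one)
  \<comment> \<open>One of \<open>lam\<close> and its inverse is at least 1, so \<open>m\<close> can
    dominate constants as well as \<open>lam\<close>.\<close>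
  have "1 \<le> lam \<or> 1 \<le> 1 / lam" using lam0 by (simp add: pos_le_divide_eq linear)
  then have m: "1 \<le> m" "lam \<le> m" "0 < m" unfolding m_def using lam0 by (auto simp: le_max_iff_disj)
  have L: "0 \<le> L" "ln (1 / \<epsilon>) \<le> L" by (auto simp: L_def)
  have aN: "real a \<le> N" using a by (simp add: N_def)
  have "ln (N * lam) \<le> N * lam" using N lam0 by (intro ln_bound) auto
  also have "\<dots> \<le> N * m" using N m by (intro mult_left_mono) auto
  finally have "real a * ln (N * lam) \<le> real a * (N * m)" by (intro mult_left_mono) auto
  also have "\<dots> \<le> N * (N * m)" using aN N m by (intro mult_right_mono) auto
  finally have log: "real a * ln (N * lam) \<le> N * N * m" by simp
  have NNm: "1 \<le> N * N * m" using mult_mono[OF mult_mono[OF N N] m(1)] N by simp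
  have "real a * ln (N * lam) + 1 + ln (1 / \<epsilon>) \<le> N * N * m + (1 + L)" using log L by simp
  also have "\<dots> \<le> N * N * m * (1 + L) + N * N * m * (1 + L)"
    using NNm L mult_left_mono[of 1 "1 + L" "N * N * m"] mult_right_mono[of 1 "N * N * m" "1 + L"]
    by (intro add_mono) auto
  finally have last: "real a * ln (N * lam) + 1 + ln (1 / \<epsilon>) \<le> 2 * (N * N * m * (1 + L))" by simp
  have "mixing_bound p n a lam \<epsilon>
      \<le> 2 * exp 1 * real a * N ^ (p + 1) * lam ^ p * (1 + m) * (2 * (N * N * m * (1 + L)))"
    unfolding mixing_bound_def N_def[symmetric] m_def[symmetric]
    using last N lam0 m by (intro mult_left_mono) auto
  also have "\<dots> \<le> 2 * exp 1 * N * N ^ (p + 1) * m ^ p * (2 * m) * (2 * (N * N * m * (1 + L)))"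
    using aN N lam0 m L by (intro mult_mono mult_nonneg_nonneg power_mono) auto
  \<comment> \<open>Beyond \<open>N ^ (p + 1)\<close> and \<open>m ^ p\<close>, the independence
    number contributes one \<open>N\<close>, the logarithmic factor \<open>N * N * m\<close>, and
    \<open>1 + m \<le> 2 * m\<close> one more \<open>m\<close>.\<close>
  also have "\<dots> = 8 * exp 1 * N ^ (p + 4) * m ^ (p + 2) * (1 + L)"
    by (simp add: power_add power4_eq_xxxx power2_eq_square mult_ac)
  finally show ?thesis by (simp add: N_def m_def L_def)
qed

theorem theorem1:
  fixes p :: nat
  assumes "2 \<le> p"
  shows
    "(\<forall>(G :: ('a, 'b) pre_digraph) (lam :: real) (\<epsilon> :: real).
        graph G \<longrightarrow> verts G \<noteq> {} \<longrightarrow> bipartite_pathwidth G \<le> int p \<longrightarrow>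
        exp 9 / real (card (verts G)) \<le> lam \<longrightarrow> 0 < \<epsilon> \<longrightarrow>
          ereal_of_enat (glauber_mixing_time G lam {} \<epsilon>)
            \<le> ereal (max 0 (mixing_bound p (card (verts G)) (independence_number G) lam \<epsilon>))) \<and>
     (\<exists>(C :: real) (k :: nat) (l :: nat).
        \<forall>(n :: nat) (a :: nat) (lam :: real) (\<epsilon> :: real).
        1 \<le> n \<longrightarrow> a \<le> n \<longrightarrow> exp 9 / real n \<le> lam \<longrightarrow> 0 < \<epsilon> \<longrightarrow>
          mixing_bound p n a lam \<epsilon>
            \<le> C * real n ^ k * max lam (1 / lam) ^ l * (1 + max 0 (ln (1 / \<epsilon>))))"
proof (intro conjI allI impI)
  fix G :: "('a, 'b) pre_digraph" and lam \<epsilon> :: real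
  assume G: "graph G" "verts G \<noteq> {}" and pw: "bipartite_pathwidth G \<le> int p"
    and lam: "exp 9 / real (card (verts G)) \<le> lam" and eps: "0 < \<epsilon>"
  interpret graph G by fact
  have n: "0 < real (card (verts G))" using G(2) by (simp add: card_gt_0_iff)
  have "0 < exp 9 / real (card (verts G))" using n by simp
  then have "0 < lam" using lam by simp
  then interpret hardcore_model G lam by unfold_locales (use G in auto)
  \<comment> \<open>The threshold on \<open>lam\<close> puts \<open>n * lam\<close> into the range
    where the subset estimates hold.\<close>
  have "exp 9 \<le> real n * lam" using lam n by (simp add: pos_divide_le_eq mult.commute)
  then have "5 \<le> real n * lam" using exp_9_ge by simp
  then show "ereal_of_enat (glauber_mixing_time G lam {} \<epsilon>)
            \<le> ereal (max 0 (mixing_bound p (card (verts G)) (independence_number G) lam \<epsilon>))"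
    using glauber_mixing_time_le pw eps by blast
next
  \<comment> \<open>The witnesses \<open>8 * exp 1\<close>, \<open>p + 4\<close> and
    \<open>p + 2\<close> depend on \<open>p\<close> alone.\<close>
  show "\<exists>(C :: real) (k :: nat) (l :: nat).
        \<forall>(n :: nat) (a :: nat) (lam :: real) (\<epsilon> :: real).
        1 \<le> n \<longrightarrow> a \<le> n \<longrightarrow> exp 9 / real n \<le> lam \<longrightarrow> 0 < \<epsilon> \<longrightarrow>
          mixing_bound p n a lam \<epsilon>
            \<le> C * real n ^ k * max lam (1 / lam) ^ l * (1 + max 0 (ln (1 / \<epsilon>)))"
    using mixing_bound_le_polynomial by blast
qed

end
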